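(* Let $F$ be a field of characteristic zero, $G$ a finite abelian group, and let $M_n(F)$ carry an elementary $G$-grading induced by $(g_1,\dots,g_n)\in G^n$ which is $G$-regular. Let $A$ be a $G$-graded PI-algebra with $T_G(A)=T_G(M_n(F))$. Then for any positive integers $d_1,\dots,d_m$, \[T_G(UT(d_1,\dots,d_m;A))=T_G(M_{d_1}(A))\,T_G(M_{d_2}(A))\cdots T_G(M_{d_m}(A)).\]
   Context: All algebras are associative and unitary. The elementary grading of $M_n(F)$ induced by $(g_1,\dots,g_n)$ gives the matrix unit $e_{ij}$ degree $g_jg_i^{-1}$. For $G$ abelian, such a grading is called $G$-regular when the map $i\mapsto g_i$ from $\{1,\dots,n\}$ to $G$ is surjective and all its fibers have the same cardinality. $F\langle X\rangle$ is the free associative algebra on $X=\bigcup_{g\in G}X^g$ (disjoint countable sets of variables of degree $g$), naturally $G$-graded; for a $G$-graded algebra $A$, $T_G(A)$ is the ideal of graded polynomial identities of $A$ (graded polynomials vanishing under all degree-preserving substitutions of homogeneous elements of $A$). The product of $T_G$-ideals is the usual product of ideals in $F\langle X\rangle$. $UT(d_1,\dots,d_m;A)$ is the algebra of block upper-triangular matrices in $M_{d_1+\cdots+d_m}(A)$ with $(r,s)$ block ($r\le s$) arbitrary $d_r\times d_s$ over $A$ and zero blocks below the diagonal; it and each $M_d(A)$ are graded by letting the degree-$g$ component consist of matrices all of whose entries lie in $A^g$. *)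

theory Defs
  imports "HOL-Algebra.Ring"
begin

record ('a, 'f, 'g) galg = "'a ring" +
  smul :: "'f \<Rightarrow> 'a \<Rightarrow> 'a"
  grade :: "'g \<Rightarrow> 'a set"

definition galgebra :: "('a, 'f::field, 'g::{ab_group_add,finite}) galg \<Rightarrow> bool" where
  "galgebra A \<longleftrightarrow> ring A \<and>
    (\<forall>c a. a \<in> carrier A \<longrightarrow> smul A c a \<in> carrier A) \<and>
    (\<forall>c d a. a \<in> carrier A \<longrightarrow> smul A (c + d) a = smul A c a \<oplus>\<^bsub>A\<^esub> smul A d a) \<and>
    (\<forall>c a b. a \<in> carrier A \<longrightarrow> b \<in> carrier A \<longrightarrow>
        smul A c (a \<oplus>\<^bsub>A\<^esub> b) = smul A c a \<oplus>\<^bsub>A\<^esub> smul A c b) \<and>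
    (\<forall>c d a. a \<in> carrier A \<longrightarrow> smul A (c * d) a = smul A c (smul A d a)) \<and>
    (\<forall>a \<in> carrier A. smul A 1 a = a) \<and>
    (\<forall>c a b. a \<in> carrier A \<longrightarrow> b \<in> carrier A \<longrightarrow>
        smul A c (a \<otimes>\<^bsub>A\<^esub> b) = smul A c a \<otimes>\<^bsub>A\<^esub> b \<and>
        smul A c (a \<otimes>\<^bsub>A\<^esub> b) = a \<otimes>\<^bsub>A\<^esub> smul A c b) \<and>
    (\<forall>g. grade A g \<subseteq> carrier A \<and> \<zero>\<^bsub>A\<^esub> \<in> grade A g \<and>
        (\<forall>a \<in> grade A g. \<forall>b \<in> grade A g. a \<oplus>\<^bsub>A\<^esub> b \<in> grade A g) \<and>
        (\<forall>c. \<forall>a \<in> grade A g. smul A c a \<in> grade A g)) \<and>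
    (\<forall>g h. \<forall>a \<in> grade A g. \<forall>b \<in> grade A h. a \<otimes>\<^bsub>A\<^esub> b \<in> grade A (g + h)) \<and>
    (\<forall>a \<in> carrier A. \<exists>!f. (\<forall>g. f g \<in> grade A g) \<and> a = finsum A f UNIV)"

text \<open>A noncommutative polynomial in variables 'v is a finitely supported map from
words (lists of variables) to coefficients.\<close>

definition fpolys :: "('v list \<Rightarrow> 'f::field) set" where
  "fpolys = {p. finite {w. p w \<noteq> 0}}"

definition pmul :: "('v list \<Rightarrow> 'f::field) \<Rightarrow> ('v list \<Rightarrow> 'f) \<Rightarrow> 'v list \<Rightarrow> 'f" where
  "pmul p q w = (\<Sum>k\<in>{0..length w}. p (take k w) * q (drop k w))"

definition word_val :: "('a, 'f, 'g) galg \<Rightarrow> ('v \<Rightarrow> 'a) \<Rightarrow> 'v list \<Rightarrow> 'a" where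
  "word_val A \<sigma> w = foldr (\<lambda>x y. x \<otimes>\<^bsub>A\<^esub> y) (map \<sigma> w) \<one>\<^bsub>A\<^esub>"

definition peval :: "('a, 'f::field, 'g) galg \<Rightarrow> ('v \<Rightarrow> 'a) \<Rightarrow> ('v list \<Rightarrow> 'f) \<Rightarrow> 'a" where
  "peval A \<sigma> p = finsum A (\<lambda>w. smul A (p w) (word_val A \<sigma> w)) {w. p w \<noteq> 0}"

text \<open>Graded polynomial identities: variables of degree g are the pairs (g, i).\<close>

definition TG :: "('a, 'f::field, 'g) galg \<Rightarrow> (('g \<times> nat) list \<Rightarrow> 'f) set" where
  "TG A = {p \<in> fpolys. \<forall>\<sigma>. (\<forall>g i. \<sigma> (g, i) \<in> grade A g) \<longrightarrow> peval A \<sigma> p = \<zero>\<^bsub>A\<^esub>}"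

definition PI_algebra :: "('a, 'f::field, 'g) galg \<Rightarrow> bool" where
  "PI_algebra A \<longleftrightarrow> (\<exists>p :: nat list \<Rightarrow> 'f. p \<in> fpolys \<and> p \<noteq> (\<lambda>_. 0) \<and>
      (\<forall>\<sigma>. (\<forall>i. \<sigma> i \<in> carrier A) \<longrightarrow> peval A \<sigma> p = \<zero>\<^bsub>A\<^esub>))"

definition ideal_prod :: "('v list \<Rightarrow> 'f::field) set \<Rightarrow> ('v list \<Rightarrow> 'f) set \<Rightarrow> ('v list \<Rightarrow> 'f) set" where
  "ideal_prod I J = {p. \<exists>L. set L \<subseteq> I \<times> J \<and>
      p = (\<lambda>w. sum_list (map (\<lambda>(a, b). pmul a b w) L))}"

fun ideal_prod_list :: "('v list \<Rightarrow> 'f::field) set list \<Rightarrow> ('v list \<Rightarrow> 'f) set" where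
  "ideal_prod_list [] = fpolys"
| "ideal_prod_list [I] = I"
| "ideal_prod_list (I # J # Is) = ideal_prod I (ideal_prod_list (J # Is))"

text \<open>M_d(A): d x d matrices over A (indices 0..d-1; entries outside are zero),
graded entrywise.\<close>

definition Mat :: "nat \<Rightarrow> ('a, 'f, 'g) galg \<Rightarrow> (nat \<Rightarrow> nat \<Rightarrow> 'a, 'f, 'g) galg" where
  "Mat d A = \<lparr> carrier = {X. (\<forall>i j. X i j \<in> carrier A) \<and>
                              (\<forall>i j. d \<le> i \<or> d \<le> j \<longrightarrow> X i j = \<zero>\<^bsub>A\<^esub>)},
     mult = (\<lambda>X Y i j. if i < d \<and> j < d then finsum A (\<lambda>k. X i k \<otimes>\<^bsub>A\<^esub> Y k j) {..<d}
                        else \<zero>\<^bsub>A\<^esub>),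
     one = (\<lambda>i j. if i = j \<and> i < d then \<one>\<^bsub>A\<^esub> else \<zero>\<^bsub>A\<^esub>),
     zero = (\<lambda>i j. \<zero>\<^bsub>A\<^esub>),
     add = (\<lambda>X Y i j. if i < d \<and> j < d then X i j \<oplus>\<^bsub>A\<^esub> Y i j else \<zero>\<^bsub>A\<^esub>),
     smul = (\<lambda>c X i j. if i < d \<and> j < d then smul A c (X i j) else \<zero>\<^bsub>A\<^esub>),
     grade = (\<lambda>g. {X. (\<forall>i j. X i j \<in> grade A g) \<and>
                        (\<forall>i j. d \<le> i \<or> d \<le> j \<longrightarrow> X i j = \<zero>\<^bsub>A\<^esub>)}) \<rparr>"

text \<open>Block index (0-based) of row/column i for block sizes ds.\<close>

definition blk :: "nat list \<Rightarrow> nat \<Rightarrow> nat" where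
  "blk ds i = card {r. r < length ds \<and> sum_list (take (Suc r) ds) \<le> i}"

definition UT :: "nat list \<Rightarrow> ('a, 'f, 'g) galg \<Rightarrow> (nat \<Rightarrow> nat \<Rightarrow> 'a, 'f, 'g) galg" where
  "UT ds A = (let M = Mat (sum_list ds) A;
                  S = {X \<in> carrier M. \<forall>i j. blk ds j < blk ds i \<longrightarrow> X i j = \<zero>\<^bsub>A\<^esub>}
              in M\<lparr> carrier := S, grade := (\<lambda>g. grade M g \<inter> S) \<rparr>)"

definition Fbase :: "('f::field, 'f, 'g::zero) galg" where
  "Fbase = \<lparr> carrier = UNIV, mult = (*), one = 1, zero = 0, add = (+),
             smul = (*), grade = (\<lambda>g. if g = 0 then UNIV else {0}) \<rparr>"

definition MatF_elem :: "nat \<Rightarrow> (nat \<Rightarrow> 'g::ab_group_add) \<Rightarrow> (nat \<Rightarrow> nat \<Rightarrow> 'f::field, 'f, 'g) galg" where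
  "MatF_elem n gs = (Mat n (Fbase :: ('f, 'f, 'g) galg)) \<lparr> grade := (\<lambda>g. {X \<in> carrier (Mat n (Fbase :: ('f, 'f, 'g) galg)).
        \<forall>i j. i < n \<longrightarrow> j < n \<longrightarrow> X i j \<noteq> 0 \<longrightarrow> gs j - gs i = g}) \<rparr>"

definition G_regular :: "nat \<Rightarrow> (nat \<Rightarrow> 'g) \<Rightarrow> bool" where
  "G_regular n gs \<longleftrightarrow> (\<forall>g. \<exists>i < n. gs i = g) \<and>
     (\<forall>g h. card {i. i < n \<and> gs i = g} = card {i. i < n \<and> gs i = h})"

end

theory Submission
  imports Defs Complex_Main "HOL-Library.Function_Algebras" "HOL-Library.Nat_Bijection"
begin

text \<open>
  Evaluating a polynomial on generic block triangular matrices turns its entries into graded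
  polynomials, so \<open>TG (UT ds A)\<close> depends only on \<open>TG A\<close>, and \<open>A\<close> may be replaced by \<open>M\<^sub>n(F)\<close>. There a
  graded identity of \<open>UT ds\<close> is a polynomial vanishing on all matrices over \<open>F\<close> that are supported
  on a given set of positions.

  Split off the first diagonal block and let \<open>I\<close>, \<open>J\<close> be the identities of this block and of the
  remaining blocks. Placing a single matrix unit \<open>e\<^sub>r\<^sub>s\<close> of degree \<open>deg x\<close> in the off-diagonal part of
  the value of \<open>x\<close> shows that an identity \<open>f\<close> satisfies
  \<open>\<Sum> f(u x v) a(u)\<^sub>i\<^sub>r b(v)\<^sub>s\<^sub>j = 0\<close>. By regularity the rows of the first block can be permuted so that
  any prescribed shift of the degrees is realised; hence \<open>(r, s)\<close> may be arbitrary, and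
  \<open>\<Sum> f(u x v) u \<otimes> v\<close> lies in \<open>I \<otimes> P + P \<otimes> J\<close>, where \<open>P\<close> is the free algebra. By Lewin's theorem
  this, together with \<open>f \<in> I \<inter> J\<close>, forces \<open>f \<in> I J\<close>.
\<close>

section \<open>Lewin's theorem in the free algebra\<close>


lemma sum_fun_apply: "(\<Sum>i\<in>S. h i) w = (\<Sum>i\<in>S. h i w)"
  by (induction S rule: infinite_finite_induct) auto

lemma additive_sum:
  fixes h :: "'a::ab_group_add \<Rightarrow> 'b::ab_group_add"
  assumes "\<And>p q. h (p + q) = h p + h q"
  shows "h (\<Sum>i\<in>S. g i) = (\<Sum>i\<in>S. h (g i))"
proof -
  have "h 0 = 0" using assms[of 0 0] by simp
  then show ?thesis by (induction S rule: infinite_finite_induct) (auto simp: assms)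
qed

text \<open>A basis of \<open>J\<close> is extended to one of \<open>P\<close>; \<pi> kills the
  former and fixes the added vectors. Since \<pi> is linear on the whole function space, additivity
  and scaling carry no membership hypotheses.\<close>

lemma complement_projection:
  fixes P J :: "('w \<Rightarrow> 'f::field) set"
  assumes J0: "0 \<in> J" and Jadd: "\<And>p q. p \<in> J \<Longrightarrow> q \<in> J \<Longrightarrow> p + q \<in> J"
    and Jscale: "\<And>c p. p \<in> J \<Longrightarrow> (\<lambda>w. c * p w) \<in> J"
    and JP: "J \<subseteq> P"
  shows "\<exists>\<pi>. (\<forall>p q. \<pi> (p + q) = \<pi> p + \<pi> q) \<and> (\<forall>c p. \<pi> (\<lambda>w. c * p w) = (\<lambda>w. c * \<pi> p w)) \<and>
    (\<forall>p\<in>J. \<pi> p = 0) \<and> (\<forall>p\<in>P. p - \<pi> p \<in> J)"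
proof -
  interpret vs: vector_space_pair "\<lambda>c p w. c * p w" "\<lambda>c p w. c * p w :: 'f"
    by unfold_locales (auto simp: algebra_simps fun_eq_iff)
  obtain C where C: "C \<subseteq> J" "vs.vs1.independent C" "J \<subseteq> vs.vs1.span C"
    using vs.vs1.maximal_independent_subset[of J] by blast
  obtain B where B: "C \<subseteq> B" "B \<subseteq> P" "vs.vs1.independent B" "P \<subseteq> vs.vs1.span B"
    using vs.vs1.maximal_independent_subset_extend[of C P] C JP by blast
  define \<pi> where "\<pi> = vs.construct B (\<lambda>b. if b \<in> C then 0 else b)"
  have lin: "Vector_Spaces.linear (\<lambda>c p w. c * p w) (\<lambda>c p w. c * p w) \<pi>"
    unfolding \<pi>_def by (rule vs.linear_construct[OF B(3)])
  have basis: "\<pi> b = (if b \<in> C then 0 else b)" if "b \<in> B" for b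
    unfolding \<pi>_def by (rule vs.construct_basis[OF B(3) that])
  have add: "\<pi> (p + q) = \<pi> p + \<pi> q" for p q
    by (rule vs.linear_add[OF lin])
  have scale: "\<pi> (\<lambda>w. c * p w) = (\<lambda>w. c * \<pi> p w)" for c p
    by (rule vs.linear_scale[OF lin])
  have zero: "\<pi> 0 = 0" by (rule vs.linear_0[OF lin])
  have J: "\<pi> p = 0" if "p \<in> J" for p
  proof -
    have "p \<in> vs.vs1.span C" using that C by blast
    then show ?thesis
    proof (induction rule: vs.vs1.span_induct_alt)
      case base show ?case by (rule zero)
    next
      case (step c x y)
      then have "\<pi> x = 0" using basis B(1) by auto
      then show ?case using step unfolding add scale by (simp add: fun_eq_iff)
    qed
  qed
  have P: "p - \<pi> p \<in> J" if "p \<in> P" for p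
  proof -
    have "p \<in> vs.vs1.span B" using that B by blast
    then show ?thesis
    proof (induction rule: vs.vs1.span_induct_alt)
      case base show ?case unfolding zero diff_self by (rule J0)
    next
      case (step c x y)
      have "x - \<pi> x \<in> J" using basis[OF step(1)] C(1) J0 by auto
      then have "(\<lambda>w. c * (x - \<pi> x) w) + (y - \<pi> y) \<in> J" using Jadd Jscale step by blast
      also have "(\<lambda>w. c * (x - \<pi> x) w) + (y - \<pi> y)
          = ((\<lambda>w. c * x w) + y) - \<pi> ((\<lambda>w. c * x w) + y)"
        by (auto simp: add scale fun_eq_iff algebra_simps)
      finally show ?case .
    qed
  qed
  show ?thesis using add scale J P by blast
qed

text \<open>Words form a basis of the free algebra, so a function \<open>F\<close> on words encodes
  a linear functional; \<open>lext F p\<close> is its value at the polynomial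
  \<open>p\<close>.\<close>

definition lext :: "('w \<Rightarrow> 'f) \<Rightarrow> ('w \<Rightarrow> 'f) \<Rightarrow> 'f::field" where
  "lext F p = (\<Sum>w | p w \<noteq> 0. p w * F w)"

lemma lext_superset:
  assumes "finite S" and "{w. p w \<noteq> 0} \<subseteq> S"
  shows "lext F p = (\<Sum>w\<in>S. p w * F w)"
  unfolding lext_def using assms by (intro sum.mono_neutral_left) auto

lemma fpolys_0: "0 \<in> fpolys"
  by (simp add: fpolys_def)

lemma fpolys_add: "p \<in> fpolys \<Longrightarrow> q \<in> fpolys \<Longrightarrow> p + q \<in> fpolys"
  unfolding fpolys_def mem_Collect_eq
  by (rule finite_subset[of _ "{w. p w \<noteq> 0} \<union> {w. q w \<noteq> 0}"]) auto

lemma fpolys_scale: "p \<in> fpolys \<Longrightarrow> (\<lambda>w. c * p w) \<in> fpolys"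
  unfolding fpolys_def mem_Collect_eq by (rule finite_subset[of _ "{w. p w \<noteq> 0}"]) auto

lemma fpolys_diff: "p \<in> fpolys \<Longrightarrow> q \<in> fpolys \<Longrightarrow> p - q \<in> fpolys"
  unfolding fpolys_def mem_Collect_eq
  by (rule finite_subset[of _ "{w. p w \<noteq> 0} \<union> {w. q w \<noteq> 0}"]) auto

lemma lext_add:
  assumes "p \<in> fpolys" and "q \<in> fpolys"
  shows "lext F (p + q) = lext F p + lext F q"
proof -
  let ?S = "{w. p w \<noteq> 0} \<union> {w. q w \<noteq> 0}"
  have fin: "finite ?S" using assms by (auto simp: fpolys_def)
  have "lext F (p + q) = (\<Sum>w\<in>?S. (p + q) w * F w)" by (rule lext_superset[OF fin]) auto
  also have "\<dots> = (\<Sum>w\<in>?S. p w * F w) + (\<Sum>w\<in>?S. q w * F w)"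
    by (simp add: sum.distrib algebra_simps)
  also have "\<dots> = lext F p + lext F q"
    using lext_superset[OF fin, of p F] lext_superset[OF fin, of q F] by auto
  finally show ?thesis .
qed

lemma lext_scale: "lext F (\<lambda>w. c * p w) = c * lext F p"
  by (cases "c = 0") (simp_all add: lext_def sum_distrib_left algebra_simps)

lemma lext_0: "lext F 0 = 0"
  by (simp add: lext_def)

lemma lext_diff:
  assumes "p \<in> fpolys" and "q \<in> fpolys"
  shows "lext F (p - q) = lext F p - lext F q"
  using lext_add[OF fpolys_diff[OF assms] assms(2), of F] by simp

section \<open>Monomials and the convolution product\<close>

definition single :: "'w \<Rightarrow> 'w \<Rightarrow> 'f::field" where
  "single u w = (if w = u then 1 else 0)"

lemma single_fpolys: "single u \<in> fpolys"
  by (simp add: fpolys_def single_def)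

lemma lext_single: "lext F (single u) = F u"
  by (simp add: lext_def single_def)

lemma fpolys_eq_sum_single:
  assumes "p \<in> fpolys"
  shows "p = (\<Sum>w | p w \<noteq> 0. (\<lambda>v. p w * single w v))"
  using assms by (auto simp: fun_eq_iff sum_fun_apply single_def fpolys_def if_distrib[of "(*) _"] cong: if_cong)

text \<open>Cutting \<open>w\<close> at a position is the same as writing \<open>w = u @ v\<close>,
  which turns the sum over cuts into a convolution over pairs of words.\<close>

lemma pmul_eq_sum_append:
  assumes "finite S" and "finite T" and "{w. p w \<noteq> 0} \<subseteq> S" and "{w. q w \<noteq> 0} \<subseteq> T"
  shows "pmul p q w = (\<Sum>(u, v)\<in>S \<times> T. if u @ v = w then p u * q v else 0)"
proof -
  let ?D = "(\<lambda>k. (take k w, drop k w)) ` {0..length w}"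
  have inj: "inj_on (\<lambda>k. (take k w, drop k w)) {0..length w}"
    by (rule inj_on_inverseI[of _ "\<lambda>(u, v). length u"]) auto
  have D: "?D = {(u, v). u @ v = w}"
  proof (intro equalityI subsetI)
    fix z assume "z \<in> {(u, v). u @ v = w}"
    then have "z = (take (length (fst z)) w, drop (length (fst z)) w)" "length (fst z) \<le> length w"
      by auto
    then show "z \<in> ?D" by (intro image_eqI) auto
  qed auto
  have fD: "finite ?D" by simp
  have "pmul p q w = (\<Sum>(u, v)\<in>?D. p u * q v)"
    unfolding pmul_def by (subst sum.reindex[OF inj]) simp
  also have "\<dots> = (\<Sum>(u, v)\<in>?D \<inter> S \<times> T. p u * q v)"
    by (rule sum.mono_neutral_right) (use fD assms in auto)
  also have "\<dots> = (\<Sum>(u, v)\<in>S \<times> T. if u @ v = w then p u * q v else 0)"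
    by (rule sum.mono_neutral_cong_left) (use assms in \<open>auto simp: D split: if_splits\<close>)
  finally show ?thesis .
qed

lemma pmul_fpolys:
  assumes "p \<in> fpolys" and "q \<in> fpolys"
  shows "pmul p q \<in> fpolys"
proof -
  let ?S = "{w. p w \<noteq> 0}" and ?T = "{w. q w \<noteq> 0}"
  have fin: "finite ?S" "finite ?T" using assms by (auto simp: fpolys_def)
  have "{w. pmul p q w \<noteq> 0} \<subseteq> (\<lambda>(u, v). u @ v) ` (?S \<times> ?T)"
  proof
    fix w assume "w \<in> {w. pmul p q w \<noteq> 0}"
    then have "\<exists>z\<in>?S \<times> ?T. (case z of (u, v) \<Rightarrow> if u @ v = w then p u * q v else 0) \<noteq> 0"
      unfolding mem_Collect_eq pmul_eq_sum_append[OF fin order_refl order_refl]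
      by (meson sum.not_neutral_contains_not_neutral)
    then show "w \<in> (\<lambda>(u, v). u @ v) ` (?S \<times> ?T)" by (force split: if_splits)
  qed
  then show ?thesis unfolding fpolys_def mem_Collect_eq
    by (rule finite_subset) (use fin in simp)
qed

lemma lext_pmul:
  assumes "p \<in> fpolys" and "q \<in> fpolys"
  shows "lext F (pmul p q) = lext (\<lambda>u. lext (\<lambda>v. F (u @ v)) q) p"
proof -
  let ?S = "{w. p w \<noteq> 0}" and ?T = "{w. q w \<noteq> 0}"
  \<comment> \<open>The concatenations are added to the support because coefficients of
    \<open>pmul p q\<close> may cancel, while every \<open>u @ v\<close> must occur in the index set
    once the sums are swapped.\<close>
  let ?W = "{w. pmul p q w \<noteq> 0} \<union> (\<lambda>(u, v). u @ v) ` (?S \<times> ?T)"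
  have fin: "finite ?S" "finite ?T" using assms by (auto simp: fpolys_def)
  have finW: "finite ?W" using fin pmul_fpolys[OF assms] by (simp add: fpolys_def)
  have "lext F (pmul p q) = (\<Sum>w\<in>?W. pmul p q w * F w)" by (rule lext_superset[OF finW]) auto
  also have "\<dots> = (\<Sum>w\<in>?W. \<Sum>(u, v)\<in>?S \<times> ?T. if u @ v = w then p u * q v * F w else 0)"
    unfolding pmul_eq_sum_append[OF fin order_refl order_refl] sum_distrib_right
    by (intro sum.cong refl) auto
  also have "\<dots> = (\<Sum>(u, v)\<in>?S \<times> ?T. \<Sum>w\<in>?W. if u @ v = w then p u * q v * F w else 0)"
    by (subst sum.swap) (simp add: split_beta)
  also have "\<dots> = (\<Sum>(u, v)\<in>?S \<times> ?T. p u * q v * F (u @ v))"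
  proof (intro sum.cong refl, clarify)
    fix u v assume "p u \<noteq> 0" "q v \<noteq> 0"
    then have "u @ v \<in> ?W" by force
    then show "(\<Sum>w\<in>?W. if u @ v = w then p u * q v * F w else 0) = p u * q v * F (u @ v)"
      using finW by (subst sum.delta') auto
  qed
  also have "\<dots> = lext (\<lambda>u. lext (\<lambda>v. F (u @ v)) q) p"
    by (simp add: lext_def sum.cartesian_product[symmetric] sum_distrib_left algebra_simps)
  finally show ?thesis .
qed

lemma pmul_add_right: "pmul p (q + r) = pmul p q + pmul p r"
  by (auto simp: pmul_def fun_eq_iff algebra_simps sum.distrib)

lemma pmul_diff_right: "pmul p (q - r) = pmul p q - pmul p r"
  by (auto simp: pmul_def fun_eq_iff algebra_simps sum_subtractf)

lemma pmul_scale_right: "pmul p (\<lambda>w. c * q w) = (\<lambda>w. c * pmul p q w)"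
  by (auto simp: pmul_def fun_eq_iff sum_distrib_left algebra_simps)

lemma pmul_add_left: "pmul (p + q) r = pmul p r + pmul q r"
  by (auto simp: pmul_def fun_eq_iff algebra_simps sum.distrib)

lemma pmul_scale_left: "pmul (\<lambda>w. c * p w) q = (\<lambda>w. c * pmul p q w)"
  by (auto simp: pmul_def fun_eq_iff sum_distrib_left algebra_simps)

lemma pmul_single_single: "pmul (single u) (single v) = (single (u @ v) :: _ \<Rightarrow> 'f::field)"
proof
  fix w
  show "pmul (single u) (single v) w = (single (u @ v) w :: 'f)"
    by (subst pmul_eq_sum_append[of "{u}" "{v}"]) (auto simp: single_def)
qed

lemma pmul_single_Nil: "pmul p (single []) = p"
proof
  fix w
  have "pmul p (single []) w = (\<Sum>k\<in>{0..length w}. if k = length w then p w else 0)"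
    unfolding pmul_def single_def by (intro sum.cong) auto
  then show "pmul p (single []) w = p w" by simp
qed

lemma pmul_single_left:
  "pmul (single u) p w = (if take (length u) w = u then p (drop (length u) w) else 0)"
proof -
  have "pmul (single u) p w
      = (\<Sum>k\<in>{0..length w}. if k = length u then (if take (length u) w = u then p (drop (length u) w) else 0) else 0)"
    unfolding pmul_def single_def by (intro sum.cong) auto
  then show ?thesis by (auto simp: min_def split: if_splits)
qed

lemma pmul_single_append: "pmul (single (u @ v)) p = pmul (single u) (pmul (single v) p)"
proof
  fix w
  have "take (length u + length v) w = u @ v
      \<longleftrightarrow> take (length u) w = u \<and> take (length v) (drop (length u) w) = v"
  proof
    assume h: "take (length u + length v) w = u @ v"
    then have "length u + length v \<le> length w" by (metis length_append length_take min.cobounded1)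
    then show "take (length u) w = u \<and> take (length v) (drop (length u) w) = v"
      using h by (simp add: take_add append_eq_append_conv)
  qed (simp add: take_add)
  then show "pmul (single (u @ v)) p w = pmul (single u) (pmul (single v) p) w"
    by (auto simp: pmul_single_left add.commute)
qed

lemma pmul_sum_left: "pmul (\<Sum>i\<in>S. h i) q = (\<Sum>i\<in>S. pmul (h i) q)"
  by (auto simp: fun_eq_iff pmul_def sum_fun_apply sum_distrib_right intro: sum.swap)

lemma fpolys_sum: "(\<And>i. i \<in> S \<Longrightarrow> h i \<in> fpolys) \<Longrightarrow> (\<Sum>i\<in>S. h i) \<in> fpolys"
  by (induction S rule: infinite_finite_induct) (auto simp: fpolys_0 fpolys_add)

lemma lext_sum:
  "(\<And>i. i \<in> S \<Longrightarrow> h i \<in> fpolys) \<Longrightarrow> lext F (\<Sum>i\<in>S. h i) = (\<Sum>i\<in>S. lext F (h i))"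
  by (induction S rule: infinite_finite_induct) (auto simp: lext_0 lext_add fpolys_sum)

text \<open>Ideals of identities are handled as annihilators of sets of functionals, so that tensors
  can be tested against pairs of functionals.\<close>

definition annih :: "('v list \<Rightarrow> 'f) set \<Rightarrow> ('v list \<Rightarrow> 'f::field) set" where
  "annih \<Lambda> = {p \<in> fpolys. \<forall>\<phi>\<in>\<Lambda>. lext \<phi> p = 0}"

lemma annih_fpolys: "p \<in> annih \<Lambda> \<Longrightarrow> p \<in> fpolys"
  by (simp add: annih_def)

text \<open>A tensor annihilated by all \<open>\<phi> \<otimes> \<psi>\<close> lies in \<open>I \<otimes> P + P \<otimes> J\<close>, stated through the
  bilinear maps out of the tensor product. The proof shortens the sum: if \<open>\<phi> (a m) \<noteq> 0\<close>, then
  \<open>b m\<close> is a combination of the other \<open>b i\<close> modulo \<open>J\<close>.\<close>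

lemma bilinear_sum_mem:
  fixes \<beta> :: "('v list \<Rightarrow> 'f::field) \<Rightarrow> ('v list \<Rightarrow> 'f) \<Rightarrow> 'm::ab_group_add"
  assumes addl: "\<And>p q v. \<beta> (p + q) v = \<beta> p v + \<beta> q v"
    and addr: "\<And>p v v'. \<beta> p (v + v') = \<beta> p v + \<beta> p v'"
    and scale: "\<And>c p v. \<beta> (\<lambda>w. c * p w) v = \<beta> p (\<lambda>w. c * v w)"
    and M0: "0 \<in> M" and Madd: "\<And>y z. y \<in> M \<Longrightarrow> z \<in> M \<Longrightarrow> y + z \<in> M"
    and left: "\<And>p v. p \<in> annih \<Lambda> \<Longrightarrow> v \<in> fpolys \<Longrightarrow> \<beta> p v \<in> M"
    and right: "\<And>p v. p \<in> fpolys \<Longrightarrow> v \<in> annih \<Lambda>' \<Longrightarrow> \<beta> p v \<in> M"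
    and "finite T" and "\<And>i. i \<in> T \<Longrightarrow> a i \<in> fpolys" and "\<And>i. i \<in> T \<Longrightarrow> b i \<in> fpolys"
    and "\<And>\<phi> \<psi>. \<phi> \<in> \<Lambda> \<Longrightarrow> \<psi> \<in> \<Lambda>' \<Longrightarrow> (\<Sum>i\<in>T. lext \<phi> (a i) * lext \<psi> (b i)) = 0"
  shows "(\<Sum>i\<in>T. \<beta> (a i) (b i)) \<in> M"
  using assms(8-)
proof (induction "card T" arbitrary: T a rule: less_induct)
  case less
  have zl: "\<beta> 0 v = 0" for v using addl[of 0 0 v] by simp
  show ?case
  proof (cases "\<forall>i\<in>T. a i \<in> annih \<Lambda>")
    case True
    have "(\<Sum>i\<in>S. \<beta> (a i) (b i)) \<in> M" if "S \<subseteq> T" for S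
      using finite_subset[OF that less(2)] that
      by (induction S rule: finite_induct) (use M0 Madd left True less(4) in auto)
    then show ?thesis by blast
  next
    case False
    then obtain m \<phi> where m: "m \<in> T" and \<phi>: "\<phi> \<in> \<Lambda>" "lext \<phi> (a m) \<noteq> 0"
      using less(3) by (auto simp: annih_def)
    \<comment> \<open>The coefficients make \<open>a' m = 0\<close>: the tensor with terms
      \<open>a i\<close>, \<open>b i\<close> becomes the one with terms \<open>a' i\<close>,
      \<open>b i\<close> over \<open>T - {m}\<close> plus the single term \<open>a m\<close>,
      \<open>j\<close>. The right factors stay fixed, so the induction varies only \<open>T\<close>
      and \<open>a\<close>.\<close>
    define c where "c i = lext \<phi> (a i) / lext \<phi> (a m)" for i
    define a' where "a' i = a i - (\<lambda>w. c i * a m w)" for i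
    define j where "j = (\<Sum>i\<in>T. (\<lambda>w. c i * b i w))"
    have jf: "j \<in> fpolys" unfolding j_def by (intro fpolys_sum fpolys_scale less)
    have jsum: "lext \<psi> j = (\<Sum>i\<in>T. c i * lext \<psi> (b i))" for \<psi>
      unfolding j_def by (subst lext_sum) (auto simp: lext_scale intro: fpolys_scale less)
    \<comment> \<open>Keeping \<phi> fixed in the vanishing hypothesis shows that every functional
      of \<open>\<Lambda>'\<close> kills \<open>j\<close>.\<close>
    have j0: "lext \<psi> j = 0" if "\<psi> \<in> \<Lambda>'" for \<psi>
    proof -
      have "lext \<psi> j * lext \<phi> (a m) = (\<Sum>i\<in>T. lext \<phi> (a i) * lext \<psi> (b i))"
        using \<phi>(2) by (simp add: jsum c_def sum_distrib_right)
      then show ?thesis using less(5)[OF \<phi>(1) that] \<phi>(2) by simp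
    qed
    have jJ: "j \<in> annih \<Lambda>'" using jf j0 by (simp add: annih_def)
    have a'f: "a' i \<in> fpolys" if "i \<in> T" for i
      unfolding a'_def by (intro fpolys_diff fpolys_scale less that m)
    have a'm: "a' m = 0" using \<phi>(2) by (auto simp: a'_def c_def fun_eq_iff)
    have le: "lext \<phi>' (a' i) = lext \<phi>' (a i) - c i * lext \<phi>' (a m)" if "i \<in> T" for i \<phi>'
      unfolding a'_def
      by (subst lext_diff) (auto simp: lext_scale intro!: fpolys_scale less that m)
    have "(\<Sum>i\<in>T - {m}. lext \<phi>' (a' i) * lext \<psi> (b i)) = 0" if "\<phi>' \<in> \<Lambda>" "\<psi> \<in> \<Lambda>'" for \<phi>' \<psi>
    proof -
      have "(\<Sum>i\<in>T - {m}. lext \<phi>' (a' i) * lext \<psi> (b i)) = (\<Sum>i\<in>T. lext \<phi>' (a' i) * lext \<psi> (b i))"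
        using less(2) m by (simp add: sum.remove a'm lext_0)
      also have "\<dots> = (\<Sum>i\<in>T. lext \<phi>' (a i) * lext \<psi> (b i)) - lext \<phi>' (a m) * lext \<psi> j"
        by (simp add: le jsum sum_distrib_left sum_subtractf[symmetric] algebra_simps)
      finally show ?thesis using less(5)[OF that] j0[OF that(2)] by simp
    qed
    then have "(\<Sum>i\<in>T - {m}. \<beta> (a' i) (b i)) \<in> M"
      using less(2,4) a'f by (intro less(1)[OF card_Diff1_less[OF less(2) m]]) auto
    moreover have "\<beta> (a m) j \<in> M" using right less(3)[OF m] jJ by blast
    moreover have "(\<Sum>i\<in>T. \<beta> (a i) (b i)) = (\<Sum>i\<in>T - {m}. \<beta> (a' i) (b i)) + \<beta> (a m) j"
    proof -
      have "\<beta> (a i) (b i) = \<beta> (a' i) (b i) + \<beta> (a m) (\<lambda>w. c i * b i w)" for i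
        unfolding scale[symmetric] addl[symmetric] by (simp add: a'_def)
      moreover have "\<beta> (a m) j = (\<Sum>i\<in>T. \<beta> (a m) (\<lambda>w. c i * b i w))"
        unfolding j_def by (rule additive_sum[of "\<beta> (a m)", OF addr])
      ultimately show ?thesis
        using less(2) m by (simp add: sum.distrib sum.remove[of T m "\<lambda>i. \<beta> (a' i) (b i)"] a'm zl)
    qed
    ultimately show ?thesis using Madd by metis
  qed
qed

section \<open>Products of ideals and the criterion for membership\<close>

lemma ideal_prod_0: "0 \<in> ideal_prod I J"
  unfolding ideal_prod_def by (auto simp: fun_eq_iff intro!: exI[of _ "[]"])

lemma ideal_prod_add:
  assumes "p \<in> ideal_prod I J" and "q \<in> ideal_prod I J"
  shows "p + q \<in> ideal_prod I J"
proof -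
  obtain L L' where "set L \<subseteq> I \<times> J" "p = (\<lambda>w. sum_list (map (\<lambda>(a, b). pmul a b w) L))"
    "set L' \<subseteq> I \<times> J" "q = (\<lambda>w. sum_list (map (\<lambda>(a, b). pmul a b w) L'))"
    using assms unfolding ideal_prod_def by blast
  then show ?thesis unfolding ideal_prod_def
    by (auto simp: fun_eq_iff intro!: exI[of _ "L @ L'"])
qed

lemma ideal_prod_sum:
  assumes "\<And>i. i \<in> S \<Longrightarrow> h i \<in> ideal_prod I J"
  shows "(\<Sum>i\<in>S. h i) \<in> ideal_prod I J"
  using assms
  by (induction S rule: infinite_finite_induct) (simp_all add: ideal_prod_0 ideal_prod_add)

lemma pmul_in_ideal_prod: "a \<in> I \<Longrightarrow> b \<in> J \<Longrightarrow> pmul a b \<in> ideal_prod I J"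
  unfolding ideal_prod_def by (intro CollectI exI[of _ "[(a, b)]"]) auto

text \<open>A pair \<open>(w, k)\<close> marks one occurrence of \<open>x\<close> in a support word,
  that is, a factorisation w = u x v with \<open>u = take k w\<close> and
  \<open>v = drop (Suc k) w\<close>.\<close>

definition splits :: "('v list \<Rightarrow> 'f::field) \<Rightarrow> 'v \<Rightarrow> ('v list \<times> nat) set" where
  "splits f x = {(w, k). f w \<noteq> 0 \<and> k < length w \<and> w ! k = x}"

text \<open>Lewin's theorem. With \<open>\<pi>\<close> a linear projection along \<open>J\<close>, the elements
  \<open>x \<pi>(v) - \<pi>(x v)\<close> of \<open>J\<close> vanish for \<open>v\<close> in \<open>J\<close>, and summing \<open>u (x \<pi>(v) - \<pi>(x v))\<close> over the
  factorisations \<open>w = u x v\<close> telescopes to \<open>w \<pi>(1) - \<pi>(w)\<close>.\<close>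

lemma mem_ideal_prod_annih:
  fixes f :: "'v list \<Rightarrow> 'f::field"
  assumes fI: "f \<in> annih \<Lambda>" and fJ: "f \<in> annih \<Lambda>'"
    and Jleft: "\<And>x p. p \<in> annih \<Lambda>' \<Longrightarrow> pmul (single [x]) p \<in> annih \<Lambda>'"
    and key: "\<And>x \<phi> \<psi>. \<phi> \<in> \<Lambda> \<Longrightarrow> \<psi> \<in> \<Lambda>' \<Longrightarrow>
      (\<Sum>(w, k)\<in>splits f x. f w * (\<phi> (take k w) * \<psi> (drop (Suc k) w))) = 0"
  shows "f \<in> ideal_prod (annih \<Lambda>) (annih \<Lambda>')"
proof -
  let ?J = "annih \<Lambda>'" and ?M = "ideal_prod (annih \<Lambda>) (annih \<Lambda>')"
  have Jadd: "p + q \<in> ?J" if "p \<in> ?J" "q \<in> ?J" for p q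
    using that by (auto simp: annih_def lext_add fpolys_add)
  have Jscale: "(\<lambda>w. c * p w) \<in> ?J" if "p \<in> ?J" for p c
    using that by (auto simp: annih_def lext_scale fpolys_scale)
  have J0: "0 \<in> ?J" by (simp add: annih_def lext_0 fpolys_0)
  have JP: "?J \<subseteq> fpolys" using annih_fpolys by blast
  have Jdiff: "p - q \<in> ?J" if "p \<in> ?J" "q \<in> ?J" for p q
    using that by (auto simp: annih_def lext_diff fpolys_diff)
  obtain \<pi> where padd: "\<And>p q. \<pi> (p + q) = \<pi> p + \<pi> q"
    and pscale: "\<And>c p. \<pi> (\<lambda>w. c * p w) = (\<lambda>w. c * \<pi> p w)"
    and pJ: "\<And>p. p \<in> ?J \<Longrightarrow> \<pi> p = 0" and pP: "\<And>p. p \<in> fpolys \<Longrightarrow> p - \<pi> p \<in> ?J"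
    using complement_projection[OF J0 Jadd Jscale JP] by blast
  have psum: "\<pi> (\<Sum>i\<in>S. h i) = (\<Sum>i\<in>S. \<pi> (h i))" for S and h :: "'i \<Rightarrow> _"
    by (rule additive_sum[of \<pi>, OF padd])
  define D where "D x v = pmul (single [x]) (\<pi> v) - \<pi> (pmul (single [x]) v)" for x v
  define \<beta> where "\<beta> x p v = pmul p (D x v)" for x p v
  \<comment> \<open>\<open>D x v\<close> equals \<open>(x v - \<pi>(x v)) - x (v - \<pi> v)\<close>,
    a difference of two elements of \<open>?J\<close>, because \<open>?J\<close> is stable under
    left multiplication by letters.\<close>
  have D: "D x v \<in> ?J" if "v \<in> fpolys" for x v
  proof -
    have "pmul (single [x]) v - \<pi> (pmul (single [x]) v) \<in> ?J"
      by (intro pP pmul_fpolys single_fpolys that)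
    then have "(pmul (single [x]) v - \<pi> (pmul (single [x]) v)) - pmul (single [x]) (v - \<pi> v) \<in> ?J"
      by (rule Jdiff) (rule Jleft[OF pP[OF that]])
    then show ?thesis by (simp add: D_def pmul_diff_right)
  qed
  have D0: "D x v = 0" if "v \<in> ?J" for x v
    using that Jleft[OF that, of x] by (auto simp: D_def pJ pmul_def fun_eq_iff)
  let ?W = "{w. f w \<noteq> 0}"
  let ?S = "SIGMA w:?W. {..<length w}"
  let ?X = "\<Union>w\<in>?W. set w"
  have fin: "finite ?W" using fI by (simp add: annih_def fpolys_def)
  then have finS: "finite ?S" and finX: "finite ?X" by auto
  have splits: "splits f x = {t \<in> ?S. fst t ! snd t = x}" for x
    by (auto simp: splits_def)
  \<comment> \<open>The coefficient of \<open>f\<close> goes into the left factor. For each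
    \<open>x\<close>, \<open>key\<close> then says that the tensor with terms \<open>a t\<close>,
    \<open>b t\<close> is killed by every pair of functionals.\<close>
  define a :: "'v list \<times> nat \<Rightarrow> _" where "a = (\<lambda>(w, k) z. f w * single (take k w) z)"
  define b :: "'v list \<times> nat \<Rightarrow> 'v list \<Rightarrow> 'f" where "b = (\<lambda>(w, k). single (drop (Suc k) w))"
  have af: "a t \<in> fpolys" and bf: "b t \<in> fpolys" for t
    by (auto simp: a_def b_def split_beta intro: fpolys_scale single_fpolys)
  \<comment> \<open>The map \<open>(p, v) \<mapsto> p (D x v)\<close> lands in \<open>?M\<close>
    when \<open>p\<close> is in the first annihilator and is zero when \<open>v\<close> is in the
    second, so \<open>bilinear_sum_mem\<close> applies to it.\<close>
  have part: "(\<Sum>t\<in>splits f x. \<beta> x (a t) (b t)) \<in> ?M" for x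
  proof (rule bilinear_sum_mem[where \<beta> = "\<beta> x" and a = a and b = b and \<Lambda> = \<Lambda> and \<Lambda>' = \<Lambda>'])
    show "\<beta> x (p + q) v = \<beta> x p v + \<beta> x q v" for p q v
      by (simp add: \<beta>_def pmul_add_left)
    show "\<beta> x p (v + v') = \<beta> x p v + \<beta> x p v'" for p v v'
      by (simp add: \<beta>_def D_def padd pmul_add_right pmul_diff_right)
    show "\<beta> x (\<lambda>w. c * p w) v = \<beta> x p (\<lambda>w. c * v w)" for c p v
      by (simp add: \<beta>_def D_def pscale pmul_scale_left pmul_scale_right pmul_diff_right)
        (simp add: fun_eq_iff algebra_simps)
    show "0 \<in> ?M" by (rule ideal_prod_0)
    show "y + z \<in> ?M" if "y \<in> ?M" "z \<in> ?M" for y z using that by (rule ideal_prod_add)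
    show "\<beta> x p v \<in> ?M" if "p \<in> annih \<Lambda>" "v \<in> fpolys" for p v
      unfolding \<beta>_def using that D by (intro pmul_in_ideal_prod)
    show "\<beta> x p v \<in> ?M" if "p \<in> fpolys" "v \<in> annih \<Lambda>'" for p v
    proof -
      have "\<beta> x p v = 0" using D0[OF that(2)] by (simp add: \<beta>_def pmul_def fun_eq_iff)
      then show ?thesis using ideal_prod_0 by simp
    qed
    show "finite (splits f x)" unfolding splits using finS by simp
    show "a t \<in> fpolys" "b t \<in> fpolys" for t by (rule af bf)+
    show "(\<Sum>t\<in>splits f x. lext \<phi> (a t) * lext \<psi> (b t)) = 0" if "\<phi> \<in> \<Lambda>" "\<psi> \<in> \<Lambda>'" for \<phi> \<psi>
      using key[OF that, of x] by (simp add: a_def b_def split_beta lext_scale lext_single algebra_simps)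
  qed
  \<comment> \<open>Sorted by the letter at the marked position, the sum over \<open>x\<close> meets
    every position of every support word exactly once.\<close>
  have "(\<Sum>x\<in>?X. \<Sum>t\<in>splits f x. \<beta> x (a t) (b t)) \<in> ?M"
    by (intro ideal_prod_sum part)
  also have "(\<Sum>x\<in>?X. \<Sum>t\<in>splits f x. \<beta> x (a t) (b t))
      = (\<Sum>x\<in>?X. \<Sum>t\<in>{t \<in> ?S. fst t ! snd t = x}. \<beta> (fst t ! snd t) (a t) (b t))"
    unfolding splits by (intro sum.cong) auto
  also have "\<dots> = (\<Sum>t\<in>?S. \<beta> (fst t ! snd t) (a t) (b t))"
    by (rule sum.group[OF finS finX]) (auto intro!: nth_mem)
  also have "\<dots> = (\<Sum>w\<in>?W. \<Sum>k<length w. \<beta> (w ! k) (a (w, k)) (b (w, k)))"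
    by (subst sum.Sigma) (use fin in \<open>auto simp: split_beta\<close>)
  also have "\<dots> = (\<Sum>w\<in>?W. (\<lambda>z. f w * (pmul (single w) (\<pi> (single [])) - \<pi> (single w)) z))"
  proof (rule sum.cong[OF refl])
    fix w
    \<comment> \<open>The term at \<open>k\<close> is \<open>f w\<close> times
      \<open>g (Suc k) - g k\<close>: the cut moves one letter to the right, and only the two
      extreme cuts survive.\<close>
    define g where "g k = pmul (single (take k w)) (\<pi> (single (drop k w)))" for k
    have "\<beta> (w ! k) (a (w, k)) (b (w, k)) = (\<lambda>z. f w * (g (Suc k) - g k) z)" if "k < length w" for k
    proof -
      have "g (Suc k) = pmul (single (take k w)) (pmul (single [w ! k]) (\<pi> (single (drop (Suc k) w))))"
        using that by (simp add: g_def take_Suc_conv_app_nth pmul_single_append)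
      moreover have "pmul (single [w ! k]) (single (drop (Suc k) w)) = (single (drop k w) :: _ \<Rightarrow> 'f)"
        using that by (simp add: pmul_single_single Cons_nth_drop_Suc)
      ultimately show ?thesis
        by (simp add: \<beta>_def D_def a_def b_def g_def pmul_scale_left pmul_diff_right)
    qed
    then have "(\<Sum>k<length w. \<beta> (w ! k) (a (w, k)) (b (w, k)))
        = (\<Sum>k<length w. (\<lambda>z. f w * (g (Suc k) - g k) z))" by simp
    also have "\<dots> = (\<lambda>z. f w * (\<Sum>k<length w. g (Suc k) - g k) z)"
      by (auto simp: fun_eq_iff sum_fun_apply sum_distrib_left)
    also have "(\<Sum>k<length w. g (Suc k) - g k) = g (length w) - g 0"
      by (rule sum_lessThan_telescope)
    also have "g 0 = \<pi> (single w)" by (auto simp: g_def pmul_single_left fun_eq_iff)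
    finally show "(\<Sum>k<length w. \<beta> (w ! k) (a (w, k)) (b (w, k)))
        = (\<lambda>z. f w * (pmul (single w) (\<pi> (single [])) - \<pi> (single w)) z)"
      by (simp add: g_def)
  qed
  also have "\<dots> = pmul f (\<pi> (single [])) - \<pi> f"
  proof -
    have f: "f = (\<Sum>w\<in>?W. (\<lambda>v. f w * single w v))"
      using annih_fpolys[OF fI] by (rule fpolys_eq_sum_single)
    have "pmul f (\<pi> (single [])) = (\<Sum>w\<in>?W. (\<lambda>z. f w * pmul (single w) (\<pi> (single [])) z))"
      by (subst f) (simp add: pmul_sum_left pmul_scale_left)
    moreover have "\<pi> f = (\<Sum>w\<in>?W. (\<lambda>z. f w * \<pi> (single w) z))"
      by (subst f) (simp add: psum pscale)
    ultimately show ?thesis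
      by (simp add: fun_eq_iff sum_fun_apply sum_subtractf algebra_simps)
  qed
  \<comment> \<open>Here \<open>\<pi> f = 0\<close> because \<open>f\<close> lies in
    \<open>?J\<close>. The complementary part \<open>f (1 - \<pi>(1))\<close> is in the product
    because \<open>f\<close> lies in the first annihilator, and the two parts add up to
    \<open>f\<close>.\<close>
  finally have "pmul f (\<pi> (single [])) \<in> ?M" using pJ[OF fJ] by simp
  moreover have "pmul f (single [] - \<pi> (single [])) \<in> ?M"
    by (intro pmul_in_ideal_prod fI pP single_fpolys)
  ultimately have "pmul f (\<pi> (single [])) + pmul f (single [] - \<pi> (single [])) \<in> ?M"
    by (rule ideal_prod_add)
  then show ?thesis by (simp add: pmul_diff_right pmul_single_Nil)
qed

section \<open>Polynomials vanishing on matrices with prescribed support\<close>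


text \<open>Entry \<open>(a, b)\<close> of the word evaluated at the matrices
  \<open>\<sigma> x\<close> with rows and columns in \<open>K\<close>. An arbitrary index set lets
  pairs serve as indices and lets a diagonal block be cut out by shrinking \<open>K\<close>.\<close>

fun ment :: "'k set \<Rightarrow> ('v \<Rightarrow> 'k \<Rightarrow> 'k \<Rightarrow> 'f::field) \<Rightarrow> 'v list \<Rightarrow> 'k \<Rightarrow> 'k \<Rightarrow> 'f" where
  "ment K \<sigma> [] a b = (if a = b then 1 else 0)"
| "ment K \<sigma> (x # w) a b = (\<Sum>c\<in>K. \<sigma> x a c * ment K \<sigma> w c b)"

text \<open>The pattern \<open>E x\<close> may depend on the variable, so one predicate expresses
  both degree conditions and block triangularity.\<close>

definition supported :: "'k set \<Rightarrow> ('v \<Rightarrow> 'k \<Rightarrow> 'k \<Rightarrow> bool) \<Rightarrow> ('v \<Rightarrow> 'k \<Rightarrow> 'k \<Rightarrow> 'f::field) \<Rightarrow> bool" where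
  "supported K E \<sigma> \<longleftrightarrow> (\<forall>x. \<forall>a\<in>K. \<forall>b\<in>K. \<sigma> x a b \<noteq> 0 \<longrightarrow> E x a b)"

text \<open>Entries are taken as functionals, so \<open>annih (entries K E)\<close> consists of the
  polynomials vanishing at all matrices supported on \<open>E\<close>.\<close>

definition entries :: "'k set \<Rightarrow> ('v \<Rightarrow> 'k \<Rightarrow> 'k \<Rightarrow> bool) \<Rightarrow> ('v list \<Rightarrow> 'f::field) set" where
  "entries K E = {(\<lambda>w. ment K \<sigma> w a b) |\<sigma> a b. supported K E \<sigma> \<and> a \<in> K \<and> b \<in> K}"

lemma entriesI: "supported K E \<sigma> \<Longrightarrow> a \<in> K \<Longrightarrow> b \<in> K \<Longrightarrow> (\<lambda>w. ment K \<sigma> w a b) \<in> entries K E"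
  unfolding entries_def by blast

lemma ment_append:
  assumes "finite K" and "a \<in> K"
  shows "ment K \<sigma> (u @ v) a b = (\<Sum>c\<in>K. ment K \<sigma> u a c * ment K \<sigma> v c b)"
  using assms(2)
proof (induction u arbitrary: a)
  case Nil
  have "(\<Sum>c\<in>K. ment K \<sigma> [] a c * ment K \<sigma> v c b) = (\<Sum>c\<in>K. if a = c then ment K \<sigma> v c b else 0)"
    by (intro sum.cong) auto
  then show ?case using Nil assms(1) by simp
next
  case (Cons x u)
  have "ment K \<sigma> ((x # u) @ v) a b = (\<Sum>d\<in>K. \<Sum>c\<in>K. \<sigma> x a d * ment K \<sigma> u d c * ment K \<sigma> v c b)"
    using Cons by (simp add: sum_distrib_left mult.assoc)
  also have "\<dots> = (\<Sum>c\<in>K. \<Sum>d\<in>K. \<sigma> x a d * ment K \<sigma> u d c * ment K \<sigma> v c b)" by (rule sum.swap)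
  finally show ?case by (simp add: sum_distrib_right)
qed

lemma ment_cong:
  assumes "\<And>x c d. c \<in> K \<Longrightarrow> d \<in> K \<Longrightarrow> \<sigma> x c d = \<sigma>' x c d" and "a \<in> K"
  shows "ment K \<sigma> w a b = ment K \<sigma>' w a b"
  using assms(2) by (induction w arbitrary: a) (auto simp: assms(1) intro!: sum.cong)

lemma ment_reindex:
  assumes bij: "bij_betw \<phi> K K'" and "a \<in> K" and b: "b \<in> K"
  shows "ment K' \<sigma> w (\<phi> a) (\<phi> b) = ment K (\<lambda>x c d. \<sigma> x (\<phi> c) (\<phi> d)) w a b"
  using assms(2)
proof (induction w arbitrary: a)
  case Nil
  then show ?case using bij b by (auto simp: bij_betw_def inj_on_def)
next
  case (Cons x w)
  show ?case using Cons by (simp add: sum.reindex_bij_betw[OF bij, symmetric])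
qed

text \<open>A bijection preserving the pattern carries supported substitutions over in both
  directions. It serves to identify the diagonal blocks of a triangular pattern with the patterns of
  shorter block lists.\<close>

lemma entries_reindex:
  assumes bij: "bij_betw \<phi> K K'"
    and E: "\<And>x a b. a \<in> K \<Longrightarrow> b \<in> K \<Longrightarrow> E' x (\<phi> a) (\<phi> b) \<longleftrightarrow> E x a b"
  shows "entries K E = (entries K' E' :: ('v list \<Rightarrow> 'f::field) set)"
proof (intro equalityI subsetI)
  fix F :: "'v list \<Rightarrow> 'f" assume "F \<in> entries K E"
  then obtain \<sigma> a b where F: "F = (\<lambda>w. ment K \<sigma> w a b)" "supported K E \<sigma>" "a \<in> K" "b \<in> K"
    unfolding entries_def by blast
  define \<sigma>' where "\<sigma>' x c d = \<sigma> x (inv_into K \<phi> c) (inv_into K \<phi> d)" for x c d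
  have inv: "inv_into K \<phi> (\<phi> c) = c" if "c \<in> K" for c
    using bij that by (simp add: bij_betw_def)
  have K': "K' = \<phi> ` K" using bij by (simp add: bij_betw_def)
  have "ment K' \<sigma>' w (\<phi> a) (\<phi> b) = ment K \<sigma> w a b" for w
    unfolding ment_reindex[OF bij F(3,4)] by (rule ment_cong) (auto simp: \<sigma>'_def inv F)
  moreover have "supported K' E' \<sigma>'"
    using F(2) by (auto simp: supported_def K' \<sigma>'_def inv E)
  ultimately show "F \<in> entries K' E'"
    using entriesI[of K' E' \<sigma>' "\<phi> a" "\<phi> b"] F K' by simp
next
  fix F :: "'v list \<Rightarrow> 'f" assume "F \<in> entries K' E'"
  then obtain \<sigma> a b where F: "F = (\<lambda>w. ment K' \<sigma> w a b)" "supported K' E' \<sigma>" "a \<in> K'" "b \<in> K'"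
    unfolding entries_def by blast
  have K': "K' = \<phi> ` K" using bij by (simp add: bij_betw_def)
  obtain a' b' where ab: "a = \<phi> a'" "b = \<phi> b'" "a' \<in> K" "b' \<in> K" using F K' by blast
  have "supported K E (\<lambda>x c d. \<sigma> x (\<phi> c) (\<phi> d))"
    using F(2) by (auto simp: supported_def K' E)
  then show "F \<in> entries K E"
    unfolding F(1) ab ment_reindex[OF bij ab(3,4)] using ab by (intro entriesI)
qed

text \<open>Linear extension of \<open>ment_append\<close>: evaluation at matrices is an algebra
  homomorphism.\<close>

lemma lext_ment_pmul:
  assumes "finite K" and "a \<in> K" and "p \<in> fpolys" and "q \<in> fpolys"
  shows "lext (\<lambda>w. ment K \<sigma> w a b) (pmul p q)
    = (\<Sum>c\<in>K. lext (\<lambda>w. ment K \<sigma> w a c) p * lext (\<lambda>w. ment K \<sigma> w c b) q)"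
proof -
  have "lext (\<lambda>v. ment K \<sigma> (u @ v) a b) q = (\<Sum>c\<in>K. ment K \<sigma> u a c * lext (\<lambda>w. ment K \<sigma> w c b) q)" for u
    unfolding lext_def ment_append[OF assms(1,2)] sum_distrib_left
    by (subst sum.swap) (simp add: algebra_simps)
  then have "lext (\<lambda>w. ment K \<sigma> w a b) (pmul p q)
      = lext (\<lambda>u. \<Sum>c\<in>K. ment K \<sigma> u a c * lext (\<lambda>w. ment K \<sigma> w c b) q) p"
    by (simp add: lext_pmul assms)
  also have "\<dots> = (\<Sum>c\<in>K. lext (\<lambda>w. ment K \<sigma> w a c) p * lext (\<lambda>w. ment K \<sigma> w c b) q)"
    unfolding lext_def[of _ p] sum_distrib_left sum_distrib_right
    by (subst sum.swap) (simp add: algebra_simps)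
  finally show ?thesis .
qed

text \<open>Supplies the stability under left multiplication that
  \<open>mem_ideal_prod_annih\<close> demands of the second annihilator.\<close>

lemma annih_entries_pmul_left:
  assumes "finite K" and "p \<in> fpolys" and "q \<in> annih (entries K E)"
  shows "pmul p q \<in> annih (entries K E)"
proof -
  have q: "q \<in> fpolys" using assms(3) by (rule annih_fpolys)
  have "lext (\<lambda>w. ment K \<sigma> w c b) q = 0" if "supported K E \<sigma>" "c \<in> K" "b \<in> K" for \<sigma> c b
    using assms(3) entriesI[OF that] by (simp add: annih_def)
  then show ?thesis
    using assms q by (auto simp: annih_def pmul_fpolys entries_def lext_ment_pmul)
qed

section \<open>Block triangular substitutions with two diagonal blocks\<close>

locale triangular =
  fixes K K1 K2 :: "'k set" and \<sigma> :: "'v \<Rightarrow> 'k \<Rightarrow> 'k \<Rightarrow> 'f::field"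
  assumes fin: "finite K" and K: "K = K1 \<union> K2" and disj: "K1 \<inter> K2 = {}"
    and low: "\<And>x a b. a \<in> K2 \<Longrightarrow> b \<in> K1 \<Longrightarrow> \<sigma> x a b = 0"
begin

lemma fin12: "finite K1" "finite K2"
  using fin K by auto

lemma sumK: "(\<Sum>c\<in>K. h c) = (\<Sum>c\<in>K1. h c) + (\<Sum>c\<in>K2. h c)"
  unfolding K using fin12 disj by (rule sum.union_disjoint)

lemma ment_low: "a \<in> K2 \<Longrightarrow> b \<in> K1 \<Longrightarrow> ment K \<sigma> w a b = 0"
  using disj by (induction w arbitrary: a) (auto simp: sumK low)

lemma ment_K1: "a \<in> K1 \<Longrightarrow> b \<in> K1 \<Longrightarrow> ment K \<sigma> w a b = ment K1 \<sigma> w a b"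
  by (induction w arbitrary: a) (auto simp: sumK ment_low)

lemma ment_K2: "a \<in> K2 \<Longrightarrow> ment K \<sigma> w a b = ment K2 \<sigma> w a b"
  by (induction w arbitrary: a) (auto simp: sumK low)

text \<open>An index path from \<open>K1\<close> to \<open>K2\<close> crosses exactly once, and by
  \<open>cross\<close> only through the entry \<open>(r, s)\<close> of the letter \<open>x\<close>.
  The summands are indexed by the position of the crossing.\<close>

lemma ment_cross:
  assumes r: "r \<in> K1" and s: "s \<in> K2" and b: "b \<in> K2" and "a \<in> K1"
    and cross: "\<And>y c d. c \<in> K1 \<Longrightarrow> d \<in> K2 \<Longrightarrow> \<sigma> y c d = (if y = x \<and> c = r \<and> d = s then 1 else 0)"
  shows "ment K \<sigma> w a b = (\<Sum>k<length w. if w ! k = x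
    then ment K1 \<sigma> (take k w) a r * ment K2 \<sigma> (drop (Suc k) w) s b else 0)"
  using \<open>a \<in> K1\<close>
proof (induction w arbitrary: a)
  case Nil
  then show ?case using b disj by auto
next
  case (Cons y w)
  let ?R = "\<lambda>k. ment K2 \<sigma> (drop (Suc k) w) s b"
  have "(\<Sum>c\<in>K1. \<sigma> y a c * ment K \<sigma> w c b)
      = (\<Sum>c\<in>K1. \<Sum>k<length w. if w ! k = x then \<sigma> y a c * ment K1 \<sigma> (take k w) c r * ?R k else 0)"
    by (intro sum.cong refl) (auto simp: Cons.IH sum_distrib_left mult.assoc intro!: sum.cong)
  also have "\<dots> = (\<Sum>k<length w. \<Sum>c\<in>K1. if w ! k = x then \<sigma> y a c * ment K1 \<sigma> (take k w) c r * ?R k else 0)"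
    by (rule sum.swap)
  also have "\<dots> = (\<Sum>k<length w. if w ! k = x then ment K1 \<sigma> (y # take k w) a r * ?R k else 0)"
    by (intro sum.cong refl) (auto simp: sum_distrib_right)
  finally have 1: "(\<Sum>c\<in>K1. \<sigma> y a c * ment K \<sigma> w c b) = \<dots>" .
  have "(\<Sum>c\<in>K2. \<sigma> y a c * ment K \<sigma> w c b) = (\<Sum>c\<in>K2. if c = s then (if y = x \<and> a = r then ment K2 \<sigma> w s b else 0) else 0)"
    using Cons.prems by (intro sum.cong) (auto simp: cross ment_K2)
  also have "\<dots> = (if y = x \<and> a = r then ment K2 \<sigma> w s b else 0)"
    using fin12 s by simp
  finally have 2: "(\<Sum>c\<in>K2. \<sigma> y a c * ment K \<sigma> w c b) = \<dots>" .
  \<comment> \<open>Crossing at the first letter is the summand at position 0; staying in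
    \<open>K1\<close> shifts the positions of the induction hypothesis by one.\<close>
  show ?case
    unfolding ment.simps(2)[of K] sumK 1 2
    by (simp add: sum.lessThan_Suc_shift del: sum.lessThan_Suc ment.simps(2) cong: if_cong)
qed

end

text \<open>The identities of a two-block pattern are the product of those of its diagonal blocks.
  The role of \<open>homog\<close> is to move \<open>r\<close>, by a symmetry of the pattern on
  \<open>K1\<close>, to a row where \<open>x\<close> may have an entry in column \<open>s\<close>;
  thus every pair \<open>(r, s)\<close> is reached in the test for Lewin's theorem.\<close>

lemma annih_entries_block:
  fixes E :: "'v \<Rightarrow> 'k \<Rightarrow> 'k \<Rightarrow> bool"
  assumes fin: "finite K" and K: "K = K1 \<union> K2" and disj: "K1 \<inter> K2 = {}"
    and low: "\<And>x a b. a \<in> K2 \<Longrightarrow> b \<in> K1 \<Longrightarrow> \<not> E x a b"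
    and homog: "\<And>x r s. r \<in> K1 \<Longrightarrow> s \<in> K2 \<Longrightarrow>
      \<exists>\<tau>. bij_betw \<tau> K1 K1 \<and> (\<forall>y. \<forall>a\<in>K1. \<forall>b\<in>K1. E y (\<tau> a) (\<tau> b) \<longleftrightarrow> E y a b) \<and> E x (\<tau> r) s"
  shows "annih (entries K E)
    = ideal_prod (annih (entries K1 E)) (annih (entries K2 E) :: ('v list \<Rightarrow> 'f::field) set)"
proof (intro equalityI subsetI)
  fix f :: "'v list \<Rightarrow> 'f" assume f: "f \<in> annih (entries K E)"
  have ff: "f \<in> fpolys" using f by (rule annih_fpolys)
  have fK: "lext (\<lambda>w. ment K \<sigma> w a b) f = 0" if "supported K E \<sigma>" "a \<in> K" "b \<in> K" for \<sigma> a b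
    using f entriesI[OF that] by (simp add: annih_def)
  have fin12: "finite K1" "finite K2" using fin K by auto
  show "f \<in> ideal_prod (annih (entries K1 E)) (annih (entries K2 E))"
  proof (rule mem_ideal_prod_annih)
    show "f \<in> annih (entries K1 E)" unfolding annih_def
    proof (intro CollectI conjI ballI ff)
      fix F :: "'v list \<Rightarrow> 'f" assume "F \<in> entries K1 E"
      then obtain \<sigma>1 a b where F: "F = (\<lambda>w. ment K1 \<sigma>1 w a b)" "supported K1 E \<sigma>1" "a \<in> K1" "b \<in> K1"
        unfolding entries_def by blast
      \<comment> \<open>Padding with zeros outside the block keeps the support and leaves the
        entries inside \<open>K1\<close> unchanged.\<close>
      define \<sigma> where "\<sigma> x c d = (if c \<in> K1 \<and> d \<in> K1 then \<sigma>1 x c d else 0)" for x c d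
      interpret triangular K K1 K2 \<sigma>
        using fin K disj by unfold_locales (auto simp: \<sigma>_def)
      have "ment K \<sigma> w a b = F w" for w
        unfolding F(1) ment_K1[OF F(3,4)] by (rule ment_cong) (auto simp: \<sigma>_def F)
      moreover have "supported K E \<sigma>" using F(2) by (auto simp: supported_def \<sigma>_def)
      ultimately show "lext F f = 0" using fK[of \<sigma> a b] F(3,4) K by simp
    qed
    show "f \<in> annih (entries K2 E)" unfolding annih_def
    proof (intro CollectI conjI ballI ff)
      fix F :: "'v list \<Rightarrow> 'f" assume "F \<in> entries K2 E"
      then obtain \<sigma>2 a b where F: "F = (\<lambda>w. ment K2 \<sigma>2 w a b)" "supported K2 E \<sigma>2" "a \<in> K2" "b \<in> K2"
        unfolding entries_def by blast
      define \<sigma> where "\<sigma> x c d = (if c \<in> K2 \<and> d \<in> K2 then \<sigma>2 x c d else 0)" for x c d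
      interpret triangular K K1 K2 \<sigma>
        using fin K disj by unfold_locales (auto simp: \<sigma>_def)
      have "ment K \<sigma> w a b = F w" for w
        unfolding F(1) ment_K2[OF F(3)] by (rule ment_cong) (auto simp: \<sigma>_def F)
      moreover have "supported K E \<sigma>" using F(2) by (auto simp: supported_def \<sigma>_def)
      ultimately show "lext F f = 0" using fK[of \<sigma> a b] F(3,4) K by simp
    qed
    show "pmul (single [x]) p \<in> annih (entries K2 E)" if "p \<in> annih (entries K2 E)" for x and p :: "'v list \<Rightarrow> 'f"
      using fin12(2) single_fpolys that by (rule annih_entries_pmul_left)
    fix x and F G :: "'v list \<Rightarrow> 'f" assume "F \<in> entries K1 E" "G \<in> entries K2 E"
    then obtain \<sigma>1 a r \<sigma>2 s b
      where F: "F = (\<lambda>w. ment K1 \<sigma>1 w a r)" "supported K1 E \<sigma>1" "a \<in> K1" "r \<in> K1"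
        and G: "G = (\<lambda>w. ment K2 \<sigma>2 w s b)" "supported K2 E \<sigma>2" "s \<in> K2" "b \<in> K2"
      unfolding entries_def by blast
    obtain \<tau> where \<tau>: "bij_betw \<tau> K1 K1"
        "\<forall>y. \<forall>a\<in>K1. \<forall>b\<in>K1. E y (\<tau> a) (\<tau> b) \<longleftrightarrow> E y a b" "E x (\<tau> r) s"
      using homog[OF F(4) G(3)] by blast
    have img: "\<tau> ` K1 = K1" and inv: "\<And>c. c \<in> K1 \<Longrightarrow> inv_into K1 \<tau> (\<tau> c) = c"
      using \<tau>(1) by (auto simp: bij_betw_def)
    \<comment> \<open>The first block is moved along \<tau>, the second is kept, and the only
      off-diagonal entry is a 1 for \<open>x\<close> at \<open>(\<tau> r, s)\<close>, which
      \<open>E\<close> permits. The last branch vanishes on rows in \<open>K2\<close> because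
      \<open>\<tau> r\<close> lies in \<open>K1\<close>.\<close>
    define \<sigma> where "\<sigma> y c d =
      (if c \<in> K1 \<and> d \<in> K1 then \<sigma>1 y (inv_into K1 \<tau> c) (inv_into K1 \<tau> d)
       else if c \<in> K2 \<and> d \<in> K2 then \<sigma>2 y c d
       else if y = x \<and> c = \<tau> r \<and> d = s then 1 else 0)" for y c d
    have mem: "\<tau> c \<in> K1" if "c \<in> K1" for c using img that by blast
    have notin: "c \<notin> K2" if "c \<in> K1" for c using that disj by blast
    interpret triangular K K1 K2 \<sigma>
      using fin K disj mem[OF F(4)] by unfold_locales (auto simp: \<sigma>_def)
    have "\<sigma> y c d \<noteq> 0 \<Longrightarrow> E y c d" if "c \<in> K" "d \<in> K" for y c d
    proof (cases "c \<in> K1 \<and> d \<in> K1")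
      case True
      then obtain c' d' where cd: "c = \<tau> c'" "d = \<tau> d'" "c' \<in> K1" "d' \<in> K1" using img by blast
      assume "\<sigma> y c d \<noteq> 0"
      then have "\<sigma>1 y c' d' \<noteq> 0" using True cd by (simp add: \<sigma>_def inv)
      then show ?thesis using F(2) cd \<tau>(2) by (simp add: supported_def)
    next
      case False
      assume "\<sigma> y c d \<noteq> 0"
      then show ?thesis using False G(2) \<tau>(3) by (auto simp: \<sigma>_def supported_def split: if_splits)
    qed
    then have "supported K E \<sigma>" by (auto simp: supported_def)
    \<comment> \<open>The entry \<open>(\<tau> a, b)\<close> of the value of \<open>f\<close> is
      expanded by \<open>ment_cross\<close>; undoing \<tau> with \<open>ment_reindex\<close> turns
      the left factors back into \<open>F\<close>.\<close>
    then have "0 = lext (\<lambda>w. ment K \<sigma> w (\<tau> a) b) f"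
      using fK mem[OF F(3)] G(4) K by simp
    also have "\<dots> = (\<Sum>w | f w \<noteq> 0. f w * (\<Sum>k<length w. if w ! k = x
        then F (take k w) * G (drop (Suc k) w) else 0))"
      unfolding lext_def
    proof (intro sum.cong refl arg_cong2[of _ _ _ _ "(*)"])
      fix w
      have "ment K \<sigma> w (\<tau> a) b = (\<Sum>k<length w. if w ! k = x
        then ment K1 \<sigma> (take k w) (\<tau> a) (\<tau> r) * ment K2 \<sigma> (drop (Suc k) w) s b else 0)"
        using mem F G notin disj by (intro ment_cross) (auto simp: \<sigma>_def)
      moreover have "ment K1 \<sigma> u (\<tau> a) (\<tau> r) = F u" for u
        unfolding ment_reindex[OF \<tau>(1) F(3,4)] F(1)
        by (rule ment_cong) (auto simp: \<sigma>_def mem inv F)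
      moreover have "ment K2 \<sigma> u s b = G u" for u
        unfolding G(1) by (rule ment_cong) (use disj in \<open>auto simp: \<sigma>_def G\<close>)
      ultimately show "ment K \<sigma> w (\<tau> a) b = (\<Sum>k<length w. if w ! k = x
        then F (take k w) * G (drop (Suc k) w) else 0)" by (simp cong: if_cong)
    qed
    also have "\<dots> = (\<Sum>w | f w \<noteq> 0. \<Sum>k<length w. if w ! k = x
        then f w * (F (take k w) * G (drop (Suc k) w)) else 0)"
      unfolding sum_distrib_left by (intro sum.cong) auto
    also have "\<dots> = (\<Sum>(w, k)\<in>(SIGMA w:{w. f w \<noteq> 0}. {..<length w}). if w ! k = x
        then f w * (F (take k w) * G (drop (Suc k) w)) else 0)"
      by (rule sum.Sigma) (use ff in \<open>auto simp: fpolys_def\<close>)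
    also have "\<dots> = (\<Sum>(w, k)\<in>splits f x. f w * (F (take k w) * G (drop (Suc k) w)))"
      by (rule sum.mono_neutral_cong_right) (use ff in \<open>auto simp: fpolys_def splits_def split: if_splits\<close>)
    finally show "(\<Sum>(w, k)\<in>splits f x. f w * (F (take k w) * G (drop (Suc k) w))) = 0" by simp
  qed
next
  fix f :: "'v list \<Rightarrow> 'f" assume "f \<in> ideal_prod (annih (entries K1 E)) (annih (entries K2 E))"
  then obtain L where L: "set L \<subseteq> annih (entries K1 E) \<times> annih (entries K2 E)"
    and f: "f = (\<lambda>w. sum_list (map (\<lambda>(p, q). pmul p q w) L))"
    unfolding ideal_prod_def by blast
  have prod: "pmul p q \<in> annih (entries K E)"
    if p: "p \<in> annih (entries K1 E)" and q: "q \<in> annih (entries K2 E)" for p q :: "'v list \<Rightarrow> 'f"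
  proof -
    have pq: "p \<in> fpolys" "q \<in> fpolys" using p q annih_fpolys by auto
    have "lext (\<lambda>w. ment K \<sigma> w a b) (pmul p q) = 0"
      if \<sigma>: "supported K E \<sigma>" and a: "a \<in> K" and b: "b \<in> K" for \<sigma> a b
    proof -
      have "\<sigma> x c d = 0" if "c \<in> K2" "d \<in> K1" for x c d
        using low[OF that] \<sigma> that unfolding K supported_def by blast
      then interpret triangular K K1 K2 \<sigma>
        using fin K disj by unfold_locales
      have \<sigma>12: "supported K1 E \<sigma>" "supported K2 E \<sigma>" using \<sigma> K by (auto simp: supported_def)
      have p0: "lext (\<lambda>w. ment K \<sigma> w c d) p = 0" if "c \<in> K1" "d \<in> K1" for c d
        using p entriesI[OF \<sigma>12(1) that] that by (simp add: annih_def ment_K1)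
      have q0: "lext (\<lambda>w. ment K \<sigma> w c d) q = 0" if "c \<in> K2" "d \<in> K2" for c d
        using q entriesI[OF \<sigma>12(2) that] that by (simp add: annih_def ment_K2)
      have l0: "lext (\<lambda>w. ment K \<sigma> w c d) h = 0" if "c \<in> K2" "d \<in> K1" for c d h
        using that by (simp add: ment_low lext_def)
      \<comment> \<open>Whichever blocks contain \<open>a\<close>, \<open>c\<close> and
        \<open>b\<close>, one factor is an entry of \<open>p\<close> inside \<open>K1\<close>, an
        entry of \<open>q\<close> inside \<open>K2\<close>, or an entry below the diagonal.\<close>
      have "lext (\<lambda>w. ment K \<sigma> w a c) p * lext (\<lambda>w. ment K \<sigma> w c b) q = 0" if "c \<in> K" for c
        using that a b p0 q0 l0 unfolding K by auto
      then show ?thesis unfolding lext_ment_pmul[OF fin a pq] by (rule sum.neutral[OF ballI])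
    qed
    then show ?thesis using pq by (auto simp: annih_def entries_def pmul_fpolys)
  qed
  have "(\<lambda>w. sum_list (map (\<lambda>(p, q). pmul p q w) L)) \<in> annih (entries K E)"
    using L
  proof (induction L)
    case Nil
    show ?case by (simp add: annih_def fpolys_def lext_def)
  next
    case (Cons z L)
    obtain p q where z: "z = (p, q)" by (cases z)
    have "pmul p q \<in> annih (entries K E)"
      "(\<lambda>w. sum_list (map (\<lambda>(p, q). pmul p q w) L)) \<in> annih (entries K E)"
      using Cons z prod by auto
    then have "pmul p q + (\<lambda>w. sum_list (map (\<lambda>(p, q). pmul p q w) L)) \<in> annih (entries K E)"
      by (simp add: annih_def fpolys_add lext_add del: plus_fun_apply)
    then show ?case by (simp add: z plus_fun_def)
  qed
  then show "f \<in> annih (entries K E)" unfolding f .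
qed

section \<open>Matrix algebras and their entries\<close>


text \<open>Common frame for \<open>UT ds A\<close> and \<open>MatF_elem n gs\<close>, whose
  gradings differ and are therefore left open. Reflexivity and transitivity of the allowed positions
  \<open>E\<close> keep the identity and all products inside them.\<close>

locale matrix_algebra = ring A for A :: "('a, 'f::field, 'g) galg" (structure) +
  fixes R :: "(nat \<Rightarrow> nat \<Rightarrow> 'a, 'f, 'g) galg" and N :: nat and E :: "nat \<Rightarrow> nat \<Rightarrow> bool"
  assumes carrier_R: "carrier R = {X. \<forall>i j. X i j \<in> carrier A \<and> (\<not> E i j \<longrightarrow> X i j = \<zero>)}"
    and mult_R: "mult R = mult (Mat N A)" and one_R: "one R = one (Mat N A)"
    and zero_R: "zero R = zero (Mat N A)" and add_R: "add R = add (Mat N A)"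
    and smul_R: "smul R = smul (Mat N A)"
    and E_less: "\<And>i j. E i j \<Longrightarrow> i < N \<and> j < N"
    and E_refl: "\<And>i. i < N \<Longrightarrow> E i i"
    and E_trans: "\<And>i j k. E i j \<Longrightarrow> E j k \<Longrightarrow> E i k"
    and smul_closed: "\<And>c a. a \<in> carrier A \<Longrightarrow> smul A c a \<in> carrier A"
    and smul_zero: "\<And>c. smul A c \<zero> = \<zero>"
begin

lemma entry_closed: "X \<in> carrier R \<Longrightarrow> X i j \<in> carrier A"
  by (simp add: carrier_R)

lemma entry_zero: "X \<in> carrier R \<Longrightarrow> \<not> E i j \<Longrightarrow> X i j = \<zero>"
  by (simp add: carrier_R)

lemma abelian_monoid_R: "abelian_monoid R"
proof (rule abelian_monoidI)
  fix X Y Z assume X: "X \<in> carrier R" and Y: "Y \<in> carrier R" and Z: "Z \<in> carrier R"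
  note c = entry_closed[OF X] entry_closed[OF Y] entry_closed[OF Z]
  have z: "X i j = \<zero>" "Y i j = \<zero>" "Z i j = \<zero>" if "\<not> (i < N \<and> j < N)" for i j
    using that E_less entry_zero X Y Z by blast+
  show "X \<oplus>\<^bsub>R\<^esub> Y \<in> carrier R"
    using X Y by (auto simp: carrier_R add_R Mat_def)
  show "X \<oplus>\<^bsub>R\<^esub> Y \<oplus>\<^bsub>R\<^esub> Z = X \<oplus>\<^bsub>R\<^esub> (Y \<oplus>\<^bsub>R\<^esub> Z)"
    using c by (auto simp: add_R Mat_def fun_eq_iff a_assoc)
  show "\<zero>\<^bsub>R\<^esub> \<oplus>\<^bsub>R\<^esub> X = X"
    using c z by (auto simp: zero_R add_R Mat_def fun_eq_iff)
  show "X \<oplus>\<^bsub>R\<^esub> Y = Y \<oplus>\<^bsub>R\<^esub> X"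
    using c by (auto simp: add_R Mat_def fun_eq_iff a_comm)
next
  show "\<zero>\<^bsub>R\<^esub> \<in> carrier R" by (simp add: carrier_R zero_R Mat_def)
qed

lemma finsum_entry:
  assumes "\<And>w. w \<in> S \<Longrightarrow> F w \<in> carrier R"
  shows "finsum R F S i j = finsum A (\<lambda>w. F w i j) S"
proof -
  interpret R: abelian_monoid R by (rule abelian_monoid_R)
  show ?thesis using assms
  proof (induction S rule: infinite_finite_induct)
    case (insert w S)
    have "F w i j \<oplus> finsum R F S i j = \<zero>" if "\<not> (i < N \<and> j < N)"
    proof -
      have "F w i j = \<zero>" "finsum R F S i j = \<zero>"
        using that E_less insert(4) by (auto intro!: entry_zero R.finsum_closed)
      then show ?thesis by simp
    qed
    then have "finsum R F (insert w S) i j = F w i j \<oplus> finsum R F S i j"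
      using insert by (auto simp: R.finsum_insert Pi_def) (auto simp: add_R Mat_def)
    then show ?case using insert entry_closed by (simp add: finsum_insert Pi_def)
  qed (auto simp: zero_R Mat_def)
qed

lemma one_closed_R: "\<one>\<^bsub>R\<^esub> \<in> carrier R"
  using E_refl by (auto simp: carrier_R one_R Mat_def)

lemma mult_entry:
  "i < N \<Longrightarrow> j < N \<Longrightarrow> (X \<otimes>\<^bsub>R\<^esub> Y) i j = finsum A (\<lambda>k. X i k \<otimes> Y k j) {..<N}"
  by (simp add: mult_R Mat_def)

lemma mult_closed_R:
  assumes X: "X \<in> carrier R" and Y: "Y \<in> carrier R"
  shows "X \<otimes>\<^bsub>R\<^esub> Y \<in> carrier R"
proof -
  have "(X \<otimes>\<^bsub>R\<^esub> Y) i j \<in> carrier A \<and> (\<not> E i j \<longrightarrow> (X \<otimes>\<^bsub>R\<^esub> Y) i j = \<zero>)" for i j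
  proof (cases "i < N \<and> j < N")
    case True
    have "X i k \<otimes> Y k j = \<zero>" if "\<not> E i j" for k
    proof (cases "E i k")
      case True
      then have "Y k j = \<zero>" using E_trans that entry_zero[OF Y] by blast
      then show ?thesis using entry_closed[OF X] by simp
    qed (use entry_zero[OF X] entry_closed[OF Y] in simp)
    then have "finsum A (\<lambda>k. X i k \<otimes> Y k j) {..<N} = \<zero>" if "\<not> E i j"
      using that by (simp add: finsum_zero)
    moreover have "finsum A (\<lambda>k. X i k \<otimes> Y k j) {..<N} \<in> carrier A"
      using entry_closed X Y by (auto intro!: finsum_closed)
    ultimately show ?thesis using True by (simp add: mult_entry)
  qed (auto simp: mult_R Mat_def)
  then show ?thesis by (simp add: carrier_R)
qed

lemma word_val_closed_R: "(\<And>x. \<sigma> x \<in> carrier R) \<Longrightarrow> word_val R \<sigma> w \<in> carrier R"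
  by (induction w) (auto simp: word_val_def one_closed_R mult_closed_R)

lemma word_val_entry_Nil:
  "i < N \<Longrightarrow> word_val R \<sigma> [] i j = (if i = j then \<one> else \<zero>)"
  by (auto simp: word_val_def one_R Mat_def)

lemma word_val_entry_Cons:
  "i < N \<Longrightarrow> j < N \<Longrightarrow>
    word_val R \<sigma> (x # w) i j = finsum A (\<lambda>k. \<sigma> x i k \<otimes> word_val R \<sigma> w k j) {..<N}"
  by (simp add: word_val_def mult_entry)

lemma smul_closed_R: "X \<in> carrier R \<Longrightarrow> smul R c X \<in> carrier R"
  by (auto simp: carrier_R smul_R Mat_def smul_closed smul_zero)

lemma peval_entry:
  assumes "\<And>x. \<sigma> x \<in> carrier R" and "i < N" and "j < N"
  shows "peval R \<sigma> f i j = finsum A (\<lambda>w. smul A (f w) (word_val R \<sigma> w i j)) {w. f w \<noteq> 0}"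
proof -
  have "peval R \<sigma> f i j = finsum A (\<lambda>w. smul R (f w) (word_val R \<sigma> w) i j) {w. f w \<noteq> 0}"
    unfolding peval_def by (rule finsum_entry) (intro smul_closed_R word_val_closed_R assms)
  then show ?thesis using assms(2,3) by (simp add: smul_R Mat_def)
qed

lemma peval_closed_R: "(\<And>x. \<sigma> x \<in> carrier R) \<Longrightarrow> peval R \<sigma> f \<in> carrier R"
  unfolding peval_def
  by (intro abelian_monoid.finsum_closed[OF abelian_monoid_R] Pi_I smul_closed_R word_val_closed_R)

lemma peval_eq_zero_iff:
  assumes "\<And>x. \<sigma> x \<in> carrier R"
  shows "peval R \<sigma> f = \<zero>\<^bsub>R\<^esub> \<longleftrightarrow> (\<forall>i<N. \<forall>j<N. peval R \<sigma> f i j = \<zero>)"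
proof -
  have "peval R \<sigma> f i j = \<zero>" if "\<not> (i < N \<and> j < N)" for i j
  proof (rule entry_zero)
    show "peval R \<sigma> f \<in> carrier R" using assms by (rule peval_closed_R)
    show "\<not> E i j" using E_less that by auto
  qed
  moreover have "\<zero>\<^bsub>R\<^esub> = (\<lambda>i j. \<zero>)" by (simp add: zero_R Mat_def)
  ultimately show ?thesis unfolding fun_eq_iff by metis
qed

end

section \<open>Elementary gradings over the base field\<close>

lemma finsum_Fbase:
  fixes h :: "'i \<Rightarrow> 'f::field"
  shows "finsum (Fbase :: ('f, 'f, 'g::zero) galg) h S = sum h S"
proof -
  have "abelian_monoid (Fbase :: ('f, 'f, 'g) galg)"
    by (rule abelian_monoidI) (auto simp: Fbase_def)
  then interpret F: abelian_monoid "Fbase :: ('f, 'f, 'g) galg" .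
  have [simp]: "\<zero>\<^bsub>Fbase :: ('f, 'f, 'g) galg\<^esub> = 0" by (simp add: Fbase_def)
  show ?thesis
  proof (induction S rule: infinite_finite_induct)
    case (insert x S)
    then show ?case by (subst F.finsum_insert) (auto simp: Fbase_def)
  qed simp_all
qed

lemma ring_Fbase: "ring (Fbase :: ('f::field, 'f, 'g::zero) galg)"
proof (rule ringI)
  show "abelian_group (Fbase :: ('f, 'f, 'g) galg)"
    by (rule abelian_groupI) (auto simp: Fbase_def intro: exI[of _ "- _"])
  show "monoid (Fbase :: ('f, 'f, 'g) galg)"
    by (rule monoidI) (auto simp: Fbase_def)
qed (auto simp: Fbase_def algebra_simps)

lemma matrix_algebra_MatF_elem:
  "matrix_algebra (Fbase :: ('f::field, 'f, 'g::ab_group_add) galg) (MatF_elem n gs) n (\<lambda>i j. i < n \<and> j < n)"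
proof -
  interpret ring "Fbase :: ('f, 'f, 'g) galg" by (rule ring_Fbase)
  show ?thesis
    by unfold_locales (auto simp: MatF_elem_def Mat_def Fbase_def)
qed

text \<open>The pattern of the elementary grading: the positions open to a variable are those whose
  matrix unit has its degree.\<close>

definition elem_deg :: "(nat \<Rightarrow> 'g::ab_group_add) \<Rightarrow> 'g \<times> nat \<Rightarrow> nat \<Rightarrow> nat \<Rightarrow> bool" where
  "elem_deg gs x r s \<longleftrightarrow> gs s - gs r = fst x"

text \<open>Homogeneous matrices of degree \<open>g\<close> are those supported on positions of
  degree \<open>g\<close>, so graded substitutions are the supported ones.\<close>

lemma TG_MatF_elem:
  "TG (MatF_elem n gs :: (nat \<Rightarrow> nat \<Rightarrow> 'f::field, 'f, 'g::ab_group_add) galg)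
    = annih (entries {..<n} (elem_deg gs))"
proof -
  let ?R = "MatF_elem n gs :: (nat \<Rightarrow> nat \<Rightarrow> 'f, 'f, 'g) galg"
  let ?F = "Fbase :: ('f, 'f, 'g) galg"
  interpret matrix_algebra ?F ?R n "\<lambda>i j. i < n \<and> j < n"
    by (rule matrix_algebra_MatF_elem)
  have grade: "X \<in> grade ?R g \<longleftrightarrow> X \<in> carrier ?R \<and> (\<forall>r<n. \<forall>s<n. X r s \<noteq> 0 \<longrightarrow> gs s - gs r = g)" for X g
    by (auto simp: MatF_elem_def)
  have word: "word_val ?R \<sigma> w r s = ment {..<n} \<sigma> w r s" if "r < n" "s < n" for \<sigma> :: "'v \<Rightarrow> _" and w r s
    using that
    by (induction w arbitrary: r)
      (auto simp: word_val_entry_Nil word_val_entry_Cons finsum_Fbase, auto simp: Fbase_def)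
  have pev: "peval ?R \<sigma> f r s = lext (\<lambda>w. ment {..<n} \<sigma> w r s) f"
    if "\<And>x. \<sigma> x \<in> carrier ?R" "r < n" "s < n" for \<sigma> :: "'v \<Rightarrow> _" and f r s
    using peval_entry[OF that] that by (simp add: finsum_Fbase word lext_def) (simp add: Fbase_def)
  show ?thesis
  proof (intro equalityI subsetI)
    fix f :: "('g \<times> nat) list \<Rightarrow> 'f" assume f: "f \<in> TG ?R"
    show "f \<in> annih (entries {..<n} (elem_deg gs))"
      unfolding annih_def
    proof (intro CollectI conjI ballI)
      show "f \<in> fpolys" using f by (simp add: TG_def)
      fix F :: "_ \<Rightarrow> 'f" assume "F \<in> entries {..<n} (elem_deg gs)"
      then obtain \<sigma> r s where F: "F = (\<lambda>w. ment {..<n} \<sigma> w r s)"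
        "supported {..<n} (elem_deg gs) \<sigma>" "r < n" "s < n"
        unfolding entries_def by blast
      \<comment> \<open>Members of the carrier vanish outside the n by n square, whereas \<sigma> is
        arbitrary there; hence the cut-off.\<close>
      define \<sigma>' where "\<sigma>' x c d = (if c < n \<and> d < n then \<sigma> x c d else 0)" for x c d
      have c: "\<sigma>' x \<in> carrier ?R" for x by (simp add: carrier_R \<sigma>'_def) (simp add: Fbase_def)
      have "\<sigma>' (g, i) \<in> grade ?R g" for g i
        using F(2) c by (auto simp: grade \<sigma>'_def supported_def elem_deg_def)
      then have "peval ?R \<sigma>' f = \<zero>\<^bsub>?R\<^esub>" using f by (auto simp: TG_def)
      then have "lext (\<lambda>w. ment {..<n} \<sigma>' w r s) f = 0"
        using F c by (simp add: pev peval_eq_zero_iff) (simp add: Fbase_def)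
      moreover have "ment {..<n} \<sigma>' w r s = F w" for w
        unfolding F(1) by (rule ment_cong) (auto simp: \<sigma>'_def F)
      ultimately show "lext F f = 0" by simp
    qed
  next
    fix f :: "('g \<times> nat) list \<Rightarrow> 'f" assume f: "f \<in> annih (entries {..<n} (elem_deg gs))"
    have "peval ?R \<sigma> f = \<zero>\<^bsub>?R\<^esub>" if \<sigma>: "\<forall>g i. \<sigma> (g, i) \<in> grade ?R g" for \<sigma> :: "'g \<times> nat \<Rightarrow> _"
    proof -
      have c: "\<sigma> x \<in> carrier ?R" for x using \<sigma> grade by (cases x) auto
      have "supported {..<n} (elem_deg gs) \<sigma>"
        using \<sigma> by (auto simp: supported_def elem_deg_def grade)
      then have "lext (\<lambda>w. ment {..<n} \<sigma> w r s) f = 0" if "r < n" "s < n" for r s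
        using f entriesI[of "{..<n}" "elem_deg gs" \<sigma> r s] that by (simp add: annih_def)
      then show ?thesis using c by (simp add: peval_eq_zero_iff pev) (simp add: Fbase_def)
    qed
    then show "f \<in> TG ?R" using annih_fpolys[OF f] by (auto simp: TG_def)
  qed
qed

section \<open>Generic matrices\<close>


text \<open>The variable with index \<open>var_index k r s\<close> stands for the entry \<open>(r, s)\<close> of the generic matrix
  substituted for the \<open>k\<close>-th variable of the same degree.\<close>

definition var_index :: "nat \<Rightarrow> nat \<Rightarrow> nat \<Rightarrow> nat" where
  "var_index k r s = prod_encode (k, prod_encode (r, s))"

definition orig :: "nat \<Rightarrow> nat" where "orig m = fst (prod_decode m)"
definition row :: "nat \<Rightarrow> nat" where "row m = fst (prod_decode (snd (prod_decode m)))"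
definition col :: "nat \<Rightarrow> nat" where "col m = snd (prod_decode (snd (prod_decode m)))"

lemma var_index_simps [simp]:
  "orig (var_index k r s) = k" "row (var_index k r s) = r" "col (var_index k r s) = s"
  "var_index (orig m) (row m) (col m) = m"
  by (simp_all add: var_index_def orig_def row_def col_def)

text \<open>Words in the generic entries that spell a walk from \<open>i\<close> to \<open>j\<close>
  through allowed positions. These are the monomials of entry \<open>(i, j)\<close> in a product of
  generic matrices.\<close>

fun is_path :: "(nat \<Rightarrow> nat \<Rightarrow> bool) \<Rightarrow> nat \<Rightarrow> nat \<Rightarrow> ('g \<times> nat) list \<Rightarrow> bool" where
  "is_path E i j [] \<longleftrightarrow> i = j"
| "is_path E i j ((g, m) # v) \<longleftrightarrow> row m = i \<and> E i (col m) \<and> is_path E (col m) j v"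

definition orig_word :: "('g \<times> nat) list \<Rightarrow> ('g \<times> nat) list" where
  "orig_word = map (\<lambda>(g, m). (g, orig m))"

definition paths :: "(nat \<Rightarrow> nat \<Rightarrow> bool) \<Rightarrow> nat \<Rightarrow> nat \<Rightarrow> ('g \<times> nat) list \<Rightarrow> ('g \<times> nat) list set" where
  "paths E i j w = {v. orig_word v = w \<and> is_path E i j v}"

text \<open>Entry \<open>(i, j)\<close> of \<open>f\<close> at generic matrices. A path determines
  the word it comes from, so each coefficient is a single coefficient of \<open>f\<close>.\<close>

definition entry_poly ::
  "(nat \<Rightarrow> nat \<Rightarrow> bool) \<Rightarrow> nat \<Rightarrow> nat \<Rightarrow> (('g \<times> nat) list \<Rightarrow> 'f::field) \<Rightarrow> ('g \<times> nat) list \<Rightarrow> 'f" where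
  "entry_poly E i j f v = (if is_path E i j v then f (orig_word v) else 0)"

lemma paths_Nil: "paths E i j [] = (if i = j then {[]} else {})"
  by (auto simp: paths_def orig_word_def)

lemma paths_Cons:
  "paths E i j ((g, k) # w) = (\<Union>s\<in>{s. E i s}. (#) (g, var_index k i s) ` paths E s j w)"
proof (intro equalityI subsetI)
  fix v assume v: "v \<in> paths E i j ((g, k) # w)"
  then obtain m v' where v': "v = (g, m) # v'" "orig m = k" "orig_word v' = w"
    by (auto simp: paths_def orig_word_def)
  then have "row m = i" "E i (col m)" "is_path E (col m) j v'" using v by (auto simp: paths_def)
  moreover have "m = var_index k i (col m)" using v'(2) calculation(1) by (metis var_index_simps(4))
  ultimately show "v \<in> (\<Union>s\<in>{s. E i s}. (#) (g, var_index k i s) ` paths E s j w)"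
    using v' by (auto simp: paths_def)
qed (auto simp: paths_def orig_word_def)

lemma finite_paths:
  assumes "\<And>i. finite {s. E i s}"
  shows "finite (paths E i j w)"
  by (induction w arbitrary: i) (auto simp: paths_Nil paths_Cons assms)

lemma disjoint_paths_Cons:
  "pairwise (\<lambda>s t. disjnt ((#) (g, var_index k i s) ` paths E s j w) ((#) (g, var_index k i t) ` paths E t j w)) S"
  by (auto simp: pairwise_def disjnt_def) (metis var_index_simps(3))

lemma disjoint_paths: "pairwise (\<lambda>w w'. disjnt (paths E i j w) (paths E i j w')) S"
  by (auto simp: pairwise_def disjnt_def paths_def)

lemma support_entry_poly: "{v. entry_poly E i j f v \<noteq> 0} = (\<Union>w\<in>{w. f w \<noteq> 0}. paths E i j w)"
  by (auto simp: entry_poly_def paths_def)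

lemma entry_poly_eq: "v \<in> paths E i j w \<Longrightarrow> entry_poly E i j f v = f w"
  by (auto simp: entry_poly_def paths_def)

lemma entry_poly_fpolys:
  assumes "\<And>i. finite {s. E i s}" and "f \<in> fpolys"
  shows "entry_poly E i j f \<in> fpolys"
  using assms(2) finite_paths[of E, OF assms(1)] by (auto simp: fpolys_def support_entry_poly)

context matrix_algebra
begin

lemma finite_E: "finite {s. E i s}"
  by (rule finite_subset[of _ "{..<N}"]) (use E_less in auto)

lemma word_val_closed: "(\<And>x. \<tau> x \<in> carrier A) \<Longrightarrow> word_val A \<tau> v \<in> carrier A"
  by (induction v) (auto simp: word_val_def)

text \<open>Expanding a product of matrices gives a sum over index paths; \<tau> specialises each
  generic entry to the corresponding entry of \<sigma>.\<close>

lemma word_val_entry_paths: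
  assumes \<tau>: "\<And>x. \<tau> x \<in> carrier A"
    and \<sigma>: "\<And>g k r s. \<sigma> (g, k) r s = (if E r s then \<tau> (g, var_index k r s) else \<zero>)"
    and j: "j < N" and "i < N"
  shows "word_val R \<sigma> w i j = finsum A (word_val A \<tau>) (paths E i j w)"
  using \<open>i < N\<close>
proof (induction w arbitrary: i)
  case Nil
  then show ?case
    by (simp add: word_val_entry_Nil paths_Nil) (simp add: word_val_def)
next
  case (Cons x w)
  obtain g k where x: "x = (g, k)" by (cases x)
  let ?W = "word_val A \<tau>"
  have fin: "finite (paths E s j w)" for s by (rule finite_paths) (rule finite_E)
  note W = word_val_closed[of \<tau>, OF \<tau>]
  have "finsum A ?W (paths E i j (x # w))
      = (\<Oplus>s\<in>{s. E i s}. finsum A ?W ((#) (g, var_index k i s) ` paths E s j w))"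
    unfolding x paths_Cons
    by (rule add.finprod_UN_disjoint) (use finite_E fin disjoint_paths_Cons W in auto)
  also have "\<dots> = (\<Oplus>s\<in>{..<N}. \<sigma> x i s \<otimes> word_val R \<sigma> w s j)"
  proof (rule add.finprod_mono_neutral_cong_left)
    fix s assume s: "s \<in> {s. E i s}"
    have "finsum A ?W ((#) (g, var_index k i s) ` paths E s j w)
        = (\<Oplus>v\<in>paths E s j w. ?W ((g, var_index k i s) # v))"
      by (rule finsum_reindex) (use W in auto)
    also have "\<dots> = (\<Oplus>v\<in>paths E s j w. \<tau> (g, var_index k i s) \<otimes> ?W v)"
      by (simp add: word_val_def)
    also have "\<dots> = \<tau> (g, var_index k i s) \<otimes> finsum A ?W (paths E s j w)"
      by (rule finsum_rdistr[symmetric]) (use fin \<tau> W in auto)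
    also have "\<dots> = \<sigma> x i s \<otimes> word_val R \<sigma> w s j"
      using s E_less Cons.IH by (auto simp: \<sigma> x)
    finally show "finsum A ?W ((#) (g, var_index k i s) ` paths E s j w) = \<sigma> x i s \<otimes> word_val R \<sigma> w s j" .
  next
    have c: "word_val R \<sigma> w s j \<in> carrier A" if "s < N" for s
      unfolding Cons.IH[OF that] using W by (auto intro: finsum_closed)
    have c': "\<sigma> x i s \<in> carrier A" for s by (simp add: \<sigma> x \<tau>)
    show "\<sigma> x i s \<otimes> word_val R \<sigma> w s j = \<zero>" if "s \<in> {..<N} - {s. E i s}" for s
      using that c by (auto simp: \<sigma> x)
    show "(\<lambda>s. \<sigma> x i s \<otimes> word_val R \<sigma> w s j) \<in> {..<N} \<rightarrow> carrier A"
      using c c' by auto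
  qed (use E_less in auto)
  also have "\<dots> = word_val R \<sigma> (x # w) i j"
    using Cons.prems j by (simp add: word_val_entry_Cons)
  finally show ?case by simp
qed

lemma peval_entry_poly:
  assumes smul_add: "\<And>c a b. a \<in> carrier A \<Longrightarrow> b \<in> carrier A \<Longrightarrow> smul A c (a \<oplus> b) = smul A c a \<oplus> smul A c b"
    and \<tau>: "\<And>x. \<tau> x \<in> carrier A"
    and \<sigma>: "\<And>g k r s. \<sigma> (g, k) r s = (if E r s then \<tau> (g, var_index k r s) else \<zero>)"
    and i: "i < N" and j: "j < N" and f: "f \<in> fpolys"
  shows "peval R \<sigma> f i j = peval A \<tau> (entry_poly E i j f)"
proof -
  let ?W = "word_val A \<tau>" and ?q = "entry_poly E i j f"
  note W = word_val_closed[of \<tau>, OF \<tau>]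
  have \<sigma>R: "\<sigma> x \<in> carrier R" for x
    by (cases x) (auto simp: carrier_R \<sigma> \<tau>)
  have smul_finsum: "smul A c (finsum A ?W S) = (\<Oplus>v\<in>S. smul A c (?W v))" for c S
    by (induction S rule: infinite_finite_induct)
      (auto simp: smul_zero smul_add smul_closed W finsum_closed Pi_def)
  have "peval R \<sigma> f i j = (\<Oplus>w\<in>{w. f w \<noteq> 0}. smul A (f w) (word_val R \<sigma> w i j))"
    by (rule peval_entry[OF \<sigma>R i j])
  also have "\<dots> = (\<Oplus>w\<in>{w. f w \<noteq> 0}. \<Oplus>v\<in>paths E i j w. smul A (f w) (?W v))"
    unfolding word_val_entry_paths[OF \<tau> \<sigma> j i] smul_finsum ..
  also have "\<dots> = (\<Oplus>w\<in>{w. f w \<noteq> 0}. \<Oplus>v\<in>paths E i j w. smul A (?q v) (?W v))"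
    by (intro finsum_cong' refl funcsetI finsum_closed smul_closed W) (simp add: entry_poly_eq)
  also have "\<dots> = (\<Oplus>v\<in>(\<Union>w\<in>{w. f w \<noteq> 0}. paths E i j w). smul A (?q v) (?W v))"
    by (rule add.finprod_UN_disjoint[symmetric])
      (use f finite_paths[of E, OF finite_E] disjoint_paths smul_closed W in \<open>auto simp: fpolys_def\<close>)
  finally show ?thesis by (simp add: peval_def support_entry_poly)
qed

end

section \<open>Identities of block triangular algebras through generic entries\<close>

lemma galgebraD:
  assumes "galgebra A"
  shows "ring A"
    and "\<And>c a. a \<in> carrier A \<Longrightarrow> smul A c a \<in> carrier A"
    and "\<And>c a b. a \<in> carrier A \<Longrightarrow> b \<in> carrier A \<Longrightarrow>
      smul A c (a \<oplus>\<^bsub>A\<^esub> b) = smul A c a \<oplus>\<^bsub>A\<^esub> smul A c b"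
    and "\<And>c a b. a \<in> carrier A \<Longrightarrow> b \<in> carrier A \<Longrightarrow>
      smul A c (a \<otimes>\<^bsub>A\<^esub> b) = smul A c a \<otimes>\<^bsub>A\<^esub> b"
    and "\<And>g. grade A g \<subseteq> carrier A"
    and "\<And>g. \<zero>\<^bsub>A\<^esub> \<in> grade A g"
  using assms unfolding galgebra_def by simp_all

definition ut_rel :: "nat list \<Rightarrow> nat \<Rightarrow> nat \<Rightarrow> bool" where
  "ut_rel ds i j \<longleftrightarrow> i < sum_list ds \<and> j < sum_list ds \<and> blk ds i \<le> blk ds j"

lemma finite_ut_rel: "finite {s. ut_rel ds i s}"
  by (rule finite_subset[of _ "{..<sum_list ds}"]) (auto simp: ut_rel_def)

lemma matrix_algebra_UT:
  assumes A: "galgebra A"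
  shows "matrix_algebra A (UT ds A) (sum_list ds) (ut_rel ds)"
proof -
  interpret ring A using A by (rule galgebraD)
  note closed = galgebraD(2)[OF A]
  have "smul A c \<zero>\<^bsub>A\<^esub> = \<zero>\<^bsub>A\<^esub>" for c
    using galgebraD(4)[OF A zero_closed zero_closed, of c] closed by simp
  then show ?thesis
    using closed
    by unfold_locales (auto simp: UT_def Let_def Mat_def ut_rel_def not_less not_le)
qed

lemma grade_UT:
  assumes "galgebra A"
  shows "X \<in> grade (UT ds A) g \<longleftrightarrow> (\<forall>i j. X i j \<in> grade A g \<and> (\<not> ut_rel ds i j \<longrightarrow> X i j = \<zero>\<^bsub>A\<^esub>))"
proof -
  have "grade A g \<subseteq> carrier A" using assms by (rule galgebraD)
  then show ?thesis by (auto simp: UT_def Let_def Mat_def ut_rel_def not_less not_le)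
qed

text \<open>Homogeneous substitutions into \<open>UT ds A\<close> are exactly those obtained by
  giving the generic entries homogeneous values in \<open>A\<close>. Hence \<open>A\<close> enters
  only through \<open>TG A\<close>.\<close>

lemma TG_UT_iff:
  assumes A: "galgebra A"
  shows "f \<in> TG (UT ds A) \<longleftrightarrow> f \<in> fpolys \<and>
    (\<forall>i<sum_list ds. \<forall>j<sum_list ds. entry_poly (ut_rel ds) i j f \<in> TG A)"
proof (cases "f \<in> fpolys")
  case f: True
  let ?N = "sum_list ds" and ?E = "ut_rel ds" and ?R = "UT ds A"
  interpret matrix_algebra A ?R ?N ?E using A by (rule matrix_algebra_UT)
  note sub = galgebraD(5)[OF A] and zero = galgebraD(6)[OF A] and smul_add = galgebraD(3)[OF A]
  have subR: "grade ?R g \<subseteq> carrier ?R" for g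
  proof
    fix X assume "X \<in> grade ?R g"
    then have "\<forall>i j. X i j \<in> grade A g \<and> (\<not> ?E i j \<longrightarrow> X i j = \<zero>\<^bsub>A\<^esub>)" by (simp add: grade_UT[OF A])
    then show "X \<in> carrier ?R" using subsetD[OF sub[of g]] by (simp add: carrier_R)
  qed
  show ?thesis
  proof
    assume fT: "f \<in> TG ?R"
    have "peval A \<tau> (entry_poly ?E i j f) = \<zero>\<^bsub>A\<^esub>"
      if i: "i < ?N" and j: "j < ?N" and \<tau>: "\<forall>g k. \<tau> (g, k) \<in> grade A g" for i j \<tau>
    proof -
      define \<sigma> where "\<sigma> = (\<lambda>(g, k) r s. if ?E r s then \<tau> (g, var_index k r s) else \<zero>\<^bsub>A\<^esub>)"
      have \<tau>A: "\<tau> x \<in> carrier A" for x using \<tau> sub by (cases x) auto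
      have "peval ?R \<sigma> f i j = peval A \<tau> (entry_poly ?E i j f)"
        by (intro peval_entry_poly smul_add \<tau>A i j f) (simp_all add: \<sigma>_def)
      moreover have \<sigma>g: "\<forall>g k. \<sigma> (g, k) \<in> grade ?R g"
        using \<tau> zero by (simp add: grade_UT[OF A] \<sigma>_def)
      then have "peval ?R \<sigma> f = \<zero>\<^bsub>?R\<^esub>" using fT by (simp add: TG_def)
      then have "peval ?R \<sigma> f i j = \<zero>\<^bsub>A\<^esub>" by (simp add: zero_R Mat_def)
      ultimately show ?thesis by simp
    qed
    then show "f \<in> fpolys \<and> (\<forall>i<?N. \<forall>j<?N. entry_poly ?E i j f \<in> TG A)"
      using f entry_poly_fpolys[OF finite_ut_rel f] by (simp add: TG_def)
  next
    assume q: "f \<in> fpolys \<and> (\<forall>i<?N. \<forall>j<?N. entry_poly ?E i j f \<in> TG A)"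
    have "peval ?R \<sigma> f = \<zero>\<^bsub>?R\<^esub>" if \<sigma>: "\<forall>g k. \<sigma> (g, k) \<in> grade ?R g" for \<sigma>
    proof -
      define \<tau> where "\<tau> = (\<lambda>(g, m). \<sigma> (g, orig m) (row m) (col m))"
      have \<tau>g: "\<forall>g m. \<tau> (g, m) \<in> grade A g" using \<sigma> by (simp add: \<tau>_def grade_UT[OF A])
      then have \<tau>: "\<tau> x \<in> carrier A" for x using sub by (cases x) auto
      have \<sigma>': "\<sigma> (g, k) r s = (if ?E r s then \<tau> (g, var_index k r s) else \<zero>\<^bsub>A\<^esub>)" for g k r s
        using \<sigma> by (simp add: \<tau>_def grade_UT[OF A])
      have \<sigma>R: "\<sigma> x \<in> carrier ?R" for x using \<sigma> subR by (cases x) auto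
      have "peval ?R \<sigma> f i j = \<zero>\<^bsub>A\<^esub>" if "i < ?N" "j < ?N" for i j
        using peval_entry_poly[OF smul_add \<tau> \<sigma>' that f] q \<tau>g that by (simp add: TG_def)
      then show ?thesis using \<sigma>R by (simp add: peval_eq_zero_iff)
    qed
    then show "f \<in> TG ?R" using f by (simp add: TG_def)
  qed
qed (simp add: TG_def)

text \<open>Analogue of \<open>word_val_entry_paths\<close> with n by n matrices as coefficients: a
  matrix of blocks is one large matrix indexed by pairs of an outer and an inner position.\<close>

lemma ment_paths:
  assumes E: "\<And>i j. E i j \<Longrightarrow> j < N"
    and \<sigma>: "\<And>g k i r j s. \<sigma> (g, k) (i, r) (j, s) = (if E i j then \<tau> (g, var_index k i j) r s else 0)"
  shows "ment ({..<N} \<times> {..<n}) \<sigma> w (i, r) (j, s) = (\<Sum>v\<in>paths E i j w. ment {..<n} \<tau> v r s)"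
proof (induction w arbitrary: i r)
  case Nil
  then show ?case by (simp add: paths_Nil)
next
  case (Cons x w)
  obtain g k where x: "x = (g, k)" by (cases x)
  have finE: "finite {s. E i s}" for i
    by (rule finite_subset[of _ "{..<N}"]) (use E in auto)
  have fin: "finite (paths E s j w)" for s by (rule finite_paths) (rule finE)
  let ?K = "{..<N} \<times> {..<n}"
  have "ment ?K \<sigma> (x # w) (i, r) (j, s)
      = (\<Sum>t<N. \<Sum>u<n. \<sigma> x (i, r) (t, u) * (\<Sum>v\<in>paths E t j w. ment {..<n} \<tau> v u s))"
    unfolding ment.simps sum.cartesian_product by (intro sum.cong) (auto simp: Cons.IH)
  also have "\<dots> = (\<Sum>t | E i t. \<Sum>u<n. \<tau> (g, var_index k i t) r u * (\<Sum>v\<in>paths E t j w. ment {..<n} \<tau> v u s))"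
    by (rule sum.mono_neutral_cong_right) (use E in \<open>auto simp: x \<sigma>\<close>)
  also have "\<dots> = (\<Sum>t | E i t. \<Sum>v\<in>paths E t j w. ment {..<n} \<tau> ((g, var_index k i t) # v) r s)"
    by (simp add: sum_distrib_left) (simp add: sum.swap[of _ "{..<n}"])
  also have "\<dots> = (\<Sum>t | E i t. \<Sum>v\<in>(#) (g, var_index k i t) ` paths E t j w. ment {..<n} \<tau> v r s)"
    by (subst sum.reindex) auto
  also have "\<dots> = (\<Sum>v\<in>paths E i j (x # w). ment {..<n} \<tau> v r s)"
    unfolding x paths_Cons
    by (rule sum.UNION_disjoint[symmetric])
      (use finE fin disjoint_paths_Cons[of g k i E j w UNIV] in \<open>auto simp: pairwise_def disjnt_def\<close>)
  finally show ?case .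
qed

lemma lext_entry_poly:
  assumes E: "\<And>i j. E i j \<Longrightarrow> j < N"
    and \<sigma>: "\<And>g k i r j s. \<sigma> (g, k) (i, r) (j, s) = (if E i j then \<tau> (g, var_index k i j) r s else 0)"
    and f: "f \<in> fpolys"
  shows "lext (\<lambda>v. ment {..<n} \<tau> v r s) (entry_poly E i j f)
    = lext (\<lambda>w. ment ({..<N} \<times> {..<n}) \<sigma> w (i, r) (j, s)) f"
proof -
  have finE: "finite {s. E i s}" for i
    by (rule finite_subset[of _ "{..<N}"]) (use E in auto)
  have "lext (\<lambda>v. ment {..<n} \<tau> v r s) (entry_poly E i j f)
      = (\<Sum>w | f w \<noteq> 0. \<Sum>v\<in>paths E i j w. entry_poly E i j f v * ment {..<n} \<tau> v r s)"
    unfolding lext_def support_entry_poly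
  proof (rule sum.UNION_disjoint)
    show "finite {w. f w \<noteq> 0}" using f by (simp add: fpolys_def)
    show "\<forall>w\<in>{w. f w \<noteq> 0}. finite (paths E i j w)" using finite_paths[of E] finE by blast
  qed (auto simp: paths_def)
  also have "\<dots> = (\<Sum>w | f w \<noteq> 0. f w * (\<Sum>v\<in>paths E i j w. ment {..<n} \<tau> v r s))"
    by (simp add: sum_distrib_left entry_poly_eq)
  also have "\<dots> = lext (\<lambda>w. ment ({..<N} \<times> {..<n}) \<sigma> w (i, r) (j, s)) f"
    unfolding lext_def by (intro sum.cong refl arg_cong2[of _ _ _ _ "(*)"] ment_paths[symmetric] E \<sigma>)
  finally show ?thesis .
qed

text \<open>Pattern of the block triangular algebra over M_n(F), written as one large matrix: the
  first component of an index carries the block structure, the second the grading.\<close>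

definition ut_deg :: "nat list \<Rightarrow> (nat \<Rightarrow> 'g::ab_group_add) \<Rightarrow> 'g \<times> nat \<Rightarrow> nat \<times> nat \<Rightarrow> nat \<times> nat \<Rightarrow> bool" where
  "ut_deg ds gs x a b \<longleftrightarrow> blk ds (fst a) \<le> blk ds (fst b) \<and> elem_deg gs x (snd a) (snd b)"

text \<open>\<open>TG_UT_iff\<close> passes to entry polynomials, \<open>T\<close> tests these on n
  by n matrices over the field, and \<open>lext_entry_poly\<close> reassembles the tests into one
  large matrix.\<close>

lemma TG_UT_eq_annih:
  fixes A :: "('a, 'f::field, 'g::{ab_group_add,finite}) galg"
  assumes A: "galgebra A" and T: "TG A = annih (entries {..<n} (elem_deg gs))"
  shows "TG (UT ds A) = annih (entries ({..<sum_list ds} \<times> {..<n}) (ut_deg ds gs))"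
proof (intro equalityI subsetI)
  let ?N = "sum_list ds" and ?E = "ut_rel ds"
  let ?K = "{..<?N} \<times> {..<n}"
  have E: "?E i j \<Longrightarrow> j < ?N" for i j by (simp add: ut_rel_def)
  {
    fix f :: "('g \<times> nat) list \<Rightarrow> 'f" assume f: "f \<in> TG (UT ds A)"
    show "f \<in> annih (entries ?K (ut_deg ds gs))" unfolding annih_def
    proof (intro CollectI conjI ballI)
      show ff: "f \<in> fpolys" using f by (simp add: TG_def)
      fix F :: "_ \<Rightarrow> 'f" assume "F \<in> entries ?K (ut_deg ds gs)"
      then obtain \<sigma> i r j s where F: "F = (\<lambda>w. ment ?K \<sigma> w (i, r) (j, s))"
          "supported ?K (ut_deg ds gs) \<sigma>" "i < ?N" "r < n" "j < ?N" "s < n"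
        unfolding entries_def by auto
      \<comment> \<open>The variable with index \<open>m\<close> receives the n by n block of
        \<sigma> at the position encoded by \<open>m\<close>, or zero if that position is
        forbidden.\<close>
      define \<tau> where "\<tau> = (\<lambda>(g, m) r s. \<sigma> (g, orig m) (row m, r) (col m, s) * (if ?E (row m) (col m) then 1 else 0))"
      define \<sigma>' where "\<sigma>' = (\<lambda>(g, k) (i, r) (j, s). if ?E i j then \<tau> (g, var_index k i j) r s else 0)"
      have "supported {..<n} (elem_deg gs) \<tau>"
        using F(2) by (auto simp: supported_def \<tau>_def ut_deg_def elem_deg_def ut_rel_def split: if_splits)
      then have "(\<lambda>v. ment {..<n} \<tau> v r s) \<in> entries {..<n} (elem_deg gs)"
        using F by (intro entriesI) auto
      moreover have "entry_poly ?E i j f \<in> annih (entries {..<n} (elem_deg gs))"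
        using f F unfolding TG_UT_iff[OF A] T by blast
      ultimately have "0 = lext (\<lambda>v. ment {..<n} \<tau> v r s) (entry_poly ?E i j f)"
        by (simp add: annih_def)
      also have "\<dots> = lext (\<lambda>w. ment ?K \<sigma>' w (i, r) (j, s)) f"
        by (rule lext_entry_poly[OF E _ ff]) (auto simp: \<sigma>'_def)
      also have "(\<lambda>w. ment ?K \<sigma>' w (i, r) (j, s)) = F"
      proof
        fix w
        \<comment> \<open>By its support condition \<sigma> already vanishes at forbidden positions,
          so the truncation changes nothing on \<open>?K\<close>.\<close>
        have "\<sigma>' x c d = \<sigma> x c d" if "c \<in> ?K" "d \<in> ?K" for x c d
          using F(2) that
          by (cases x; cases c; cases d) (fastforce simp: \<sigma>'_def \<tau>_def ut_rel_def supported_def ut_deg_def)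
        then show "ment ?K \<sigma>' w (i, r) (j, s) = F w"
          unfolding F(1) by (rule ment_cong) (use F in auto)
      qed
      finally show "lext F f = 0" by simp
    qed
  next
    fix f :: "('g \<times> nat) list \<Rightarrow> 'f" assume f: "f \<in> annih (entries ?K (ut_deg ds gs))"
    have ff: "f \<in> fpolys" using f by (rule annih_fpolys)
    have "entry_poly ?E i j f \<in> annih (entries {..<n} (elem_deg gs))" if ij: "i < ?N" "j < ?N" for i j
      unfolding annih_def
    proof (intro CollectI conjI ballI)
      show "entry_poly ?E i j f \<in> fpolys" using finite_ut_rel ff by (rule entry_poly_fpolys)
      fix F :: "('g \<times> nat) list \<Rightarrow> 'f" assume "F \<in> entries {..<n} (elem_deg gs)"
      then obtain \<tau> r s where F: "F = (\<lambda>w. ment {..<n} \<tau> w r s)"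
          "supported {..<n} (elem_deg gs) \<tau>" "r < n" "s < n"
        unfolding entries_def by auto
      define \<sigma> where "\<sigma> = (\<lambda>(g, k) (i, r) (j, s). if ?E i j then \<tau> (g, var_index k i j) r s else 0)"
      have "supported ?K (ut_deg ds gs) \<sigma>"
        using F(2) by (auto simp: supported_def \<sigma>_def ut_deg_def elem_deg_def ut_rel_def)
      then have "(\<lambda>w. ment ?K \<sigma> w (i, r) (j, s)) \<in> entries ?K (ut_deg ds gs)"
        using F ij by (intro entriesI) auto
      then have "lext (\<lambda>w. ment ?K \<sigma> w (i, r) (j, s)) f = 0" using f by (simp add: annih_def)
      moreover have "lext F (entry_poly ?E i j f) = lext (\<lambda>w. ment ?K \<sigma> w (i, r) (j, s)) f"
        unfolding F(1) by (rule lext_entry_poly[OF E _ ff]) (auto simp: \<sigma>_def)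
      ultimately show "lext F (entry_poly ?E i j f) = 0" by simp
    qed
    then show "f \<in> TG (UT ds A)" unfolding TG_UT_iff[OF A] T using ff by blast
  }
qed

section \<open>Splitting off the first block\<close>

text \<open>For \<open>i \<ge> d\<close> the end of the first block adds one to the count, and the
  later block ends are those of \<open>ds\<close> moved by \<open>d\<close>.\<close>

lemma blk_Cons: "blk (d # ds) i = (if i < d then 0 else Suc (blk ds (i - d)))"
proof (cases "i < d")
  case False
  let ?S = "{r. r < length ds \<and> sum_list (take (Suc r) ds) \<le> i - d}"
  have "{r. r < length (d # ds) \<and> sum_list (take (Suc r) (d # ds)) \<le> i} = insert 0 (Suc ` ?S)"
  proof (rule Set.set_eqI)
    fix r
    show "r \<in> {r. r < length (d # ds) \<and> sum_list (take (Suc r) (d # ds)) \<le> i} \<longleftrightarrow> r \<in> insert 0 (Suc ` ?S)"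
      using False by (cases r) auto
  qed
  moreover have "card (insert 0 (Suc ` ?S)) = Suc (card ?S)"
    by (subst card_insert_disjoint) (auto simp: card_image)
  ultimately show ?thesis using False by (simp add: blk_def del: take_Suc_Cons)
qed (auto simp: blk_def)

lemma blk_Nil: "blk [] i = 0"
  by (simp add: blk_def)

text \<open>Indices below \<open>d\<close> all lie in block 0, and the remaining entries are zero in
  both algebras. This brings the factors \<open>TG (Mat d A)\<close> under the description obtained
  for \<open>UT\<close>.\<close>

lemma Mat_eq_UT:
  assumes "galgebra A"
  shows "Mat d A = UT [d] A"
proof -
  have "grade A g \<subseteq> carrier A" for g using assms by (rule galgebraD)
  then show ?thesis
    by (auto simp: UT_def Let_def Mat_def blk_Cons blk_Nil fun_eq_iff subset_iff)
qed

text \<open>All fibres of \<open>gs\<close> have the same size, so the fibre over \<open>g\<close>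
  can be matched with the one over \<open>g + h\<close> for every \<open>g\<close>; these bijections
  glue to a permutation.\<close>

lemma G_regular_shift:
  fixes gs :: "nat \<Rightarrow> 'g::ab_group_add"
  assumes "G_regular n gs"
  shows "\<exists>\<phi>. bij_betw \<phi> {..<n} {..<n} \<and> (\<forall>i<n. gs (\<phi> i) = gs i + h)"
proof -
  let ?S = "\<lambda>g. {i. i < n \<and> gs i = g}"
  have "\<exists>b. bij_betw b (?S g) (?S (g + h))" for g
    by (rule finite_same_card_bij) (use assms in \<open>auto simp: G_regular_def\<close>)
  then obtain b where b: "\<And>g. bij_betw (b g) (?S g) (?S (g + h))" by metis
  define \<phi> where "\<phi> i = b (gs i) i" for i
  have mem: "\<phi> i < n \<and> gs (\<phi> i) = gs i + h" if "i < n" for i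
    using bij_betwE[OF b[of "gs i"]] that by (auto simp: \<phi>_def)
  have "inj_on \<phi> {..<n}"
  proof (rule inj_onI)
    fix i j assume ij: "i \<in> {..<n}" "j \<in> {..<n}" "\<phi> i = \<phi> j"
    then have "gs i = gs j" using mem[of i] mem[of j] by auto
    then show "i = j" using ij bij_betw_imp_inj_on[OF b[of "gs i"]] by (auto simp: \<phi>_def inj_on_def)
  qed
  moreover have "\<phi> ` {..<n} \<subseteq> {..<n}" using mem by auto
  ultimately have "bij_betw \<phi> {..<n} {..<n}"
    using endo_inj_surj[of "{..<n}" \<phi>] by (simp add: bij_betw_def)
  then show ?thesis using mem by blast
qed

text \<open>Instance of \<open>annih_entries_block\<close> in which the symmetries of the first
  block permute only the inner index.\<close>

lemma annih_ut_deg_Cons: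
  fixes gs :: "nat \<Rightarrow> 'g::ab_group_add"
  assumes reg: "G_regular n gs"
  shows "annih (entries ({..<sum_list (d # ds)} \<times> {..<n}) (ut_deg (d # ds) gs))
    = ideal_prod (annih (entries ({..<sum_list [d]} \<times> {..<n}) (ut_deg [d] gs)))
        (annih (entries ({..<sum_list ds} \<times> {..<n}) (ut_deg ds gs)) :: (('g \<times> nat) list \<Rightarrow> 'f::field) set)"
proof -
  let ?K1 = "{..<d} \<times> {..<n}" and ?K2 = "{d..<d + sum_list ds} \<times> {..<n}"
  let ?E = "ut_deg (d # ds) gs"
  have 1: "entries ?K1 ?E = (entries ({..<sum_list [d]} \<times> {..<n}) (ut_deg [d] gs) :: (('g \<times> nat) list \<Rightarrow> 'f) set)"
    by (rule entries_reindex[of id]) (auto simp: ut_deg_def blk_Cons bij_betw_def)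
  have 2: "entries ({..<sum_list ds} \<times> {..<n}) (ut_deg ds gs) = (entries ?K2 ?E :: (('g \<times> nat) list \<Rightarrow> 'f) set)"
  proof (rule entries_reindex)
    show "bij_betw (\<lambda>(i, r). (i + d, r)) ({..<sum_list ds} \<times> {..<n}) ?K2"
      by (rule bij_betw_byWitness[where f' = "\<lambda>(i, r). (i - d, r)"]) auto
  qed (auto simp: ut_deg_def blk_Cons)
  have "annih (entries ({..<sum_list (d # ds)} \<times> {..<n}) ?E)
      = ideal_prod (annih (entries ?K1 ?E)) (annih (entries ?K2 ?E) :: (('g \<times> nat) list \<Rightarrow> 'f) set)"
  proof (rule annih_entries_block)
    show "{..<sum_list (d # ds)} \<times> {..<n} = ?K1 \<union> ?K2" by auto
    show "?K1 \<inter> ?K2 = {}" by auto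
    show "\<not> ?E x a b" if "a \<in> ?K2" "b \<in> ?K1" for x a b
      using that by (auto simp: ut_deg_def blk_Cons)
    fix x :: "'g \<times> nat" and r s assume r: "r \<in> ?K1" and s: "s \<in> ?K2"
    \<comment> \<open>Chosen so that the position of the moved \<open>r\<close> and \<open>s\<close>
      has degree \<open>fst x\<close>. A common shift leaves all differences of degrees within the
      first block unchanged, hence also its pattern.\<close>
    define h where "h = gs (snd s) - gs (snd r) - fst x"
    obtain \<phi> where \<phi>: "bij_betw \<phi> {..<n} {..<n}" "\<And>i. i < n \<Longrightarrow> gs (\<phi> i) = gs i + h"
      using G_regular_shift[OF reg] by blast
    have "bij_betw (map_prod id \<phi>) ?K1 ?K1"
      using \<phi>(1) by (intro bij_betw_map_prod) auto
    moreover have "\<forall>y. \<forall>a\<in>?K1. \<forall>b\<in>?K1. ?E y (map_prod id \<phi> a) (map_prod id \<phi> b) \<longleftrightarrow> ?E y a b"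
      by (auto simp: ut_deg_def elem_deg_def \<phi>(2))
    moreover have "?E x (map_prod id \<phi> r) s"
      using r s by (auto simp: ut_deg_def elem_deg_def \<phi>(2) blk_Cons h_def)
    ultimately show "\<exists>\<tau>. bij_betw \<tau> ?K1 ?K1 \<and>
        (\<forall>y. \<forall>a\<in>?K1. \<forall>b\<in>?K1. ?E y (\<tau> a) (\<tau> b) \<longleftrightarrow> ?E y a b) \<and> ?E x (\<tau> r) s" by blast
  qed auto
  then show ?thesis unfolding 1 2 .
qed

section \<open>The product formula by induction on the number of blocks\<close>

theorem theorem5p4:
  fixes A :: "('a, 'f::field_char_0, 'g::{ab_group_add,finite}) galg"
    and n :: nat and gs :: "nat \<Rightarrow> 'g" and ds :: "nat list"
  assumes "galgebra A"
    and "G_regular n gs"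
    and "PI_algebra A"
    and "TG A = TG (MatF_elem n gs :: (nat \<Rightarrow> nat \<Rightarrow> 'f, 'f, 'g) galg)"
    and "ds \<noteq> []" and "\<forall>d \<in> set ds. 0 < d"
  shows "TG (UT ds A) = ideal_prod_list (map (\<lambda>d. TG (Mat d A)) ds)"
proof -
  have T: "TG A = annih (entries {..<n} (elem_deg gs))"
    using assms(4) by (simp add: TG_MatF_elem)
  note UT = TG_UT_eq_annih[OF assms(1) T]
  show ?thesis
    using assms(5)
  \<comment> \<open>This rule follows the equations of \<open>ideal_prod_list\<close>, where a
    single ideal is the base and no trailing factor appears.\<close>
  proof (induction ds rule: induct_list012)
    case (2 d)
    show ?case by (simp add: Mat_eq_UT[OF assms(1)])
  next
    case (3 d e ds)
    have "TG (UT (d # e # ds) A) = ideal_prod (TG (UT [d] A)) (TG (UT (e # ds) A))"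
      unfolding UT by (rule annih_ut_deg_Cons[OF assms(2)])
    then show ?case using 3 by (simp add: Mat_eq_UT[OF assms(1)])
  qed simp
qed

end
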